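(* The function $F_2$ is given by the formula \begin{align*} F_2(z)=&\frac{1}{2}\frac{(1-\vert z\vert^2)^4}{\vert1-z\vert^2} +\frac{3}{2}\frac{(1-\vert z\vert^2)^5}{\vert1-z\vert^4} -\frac{3}{2}\frac{(1-\vert z\vert^2)^4}{\vert1-z\vert^4}\\ &+\frac{3}{2}\frac{(1-\vert z\vert^2)^6}{\vert1-z\vert^6} -\frac{3}{2}\frac{(1-\vert z\vert^2)^5}{\vert1-z\vert^6} +\frac{1}{2}\frac{(1-\vert z\vert^2)^7}{\vert1-z\vert^8}, \quad z\in\mathbb{D}. \end{align*}
   Context: Let $\mathbb{D}$ be the unit disc, $\mathbb{T}=\partial\mathbb{D}$ the unit circle, $\Delta=\partial^2/\partial z\partial\bar z$, and for $\gamma>-1$ let $w_\gamma(z)=(1-\lvert z\rvert^2)^\gamma$, $z\in\mathbb{D}$. For a smooth function $u$ in $\mathbb{D}$ write $u_r(e^{i\theta})=u(re^{i\theta})$ for $0\le r<1$. We say $u=f_0$ on $\mathbb{T}$ (with $f_0\in\mathcal{D}'(\mathbb{T})$) if $\lim_{r\to1}u_r=f_0$ in $\mathcal{D}'(\mathbb{T})$, and the inward normal derivative is $\partial_n u=\lim_{r\to1}(u_r-f_0)/(1-r)$ in $\mathcal{D}'(\mathbb{T})$ when the limit exists. The Poisson kernel $F_\gamma$ is the (unique) solution, in this distributional sense, of $\Delta w_\gamma^{-1}\Delta F_\gamma=0$ in $\mathbb{D}$, $F_\gamma=\delta_1$ on $\mathbb{T}$, $\partial_n F_\gamma=0$ on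 $\mathbb{T}$, where $\delta_1$ is the unit Dirac mass at $1\in\mathbb{T}$. Here $\gamma=2$. *)

theory Defs
  imports "HOL-Analysis.Analysis"
begin

text \<open>Functions on the disc are viewed as functions of two real variables
  (complex plane = R^2). Real partial derivative of f at z in direction v
  (v = 1 gives d/dx, v = i gives d/dy).\<close>
definition pd :: "complex \<Rightarrow> (complex \<Rightarrow> complex) \<Rightarrow> complex \<Rightarrow> complex" where
  "pd v f z = vector_derivative (\<lambda>t::real. f (z + of_real t * v)) (at 0)"

fun ipd :: "complex list \<Rightarrow> (complex \<Rightarrow> complex) \<Rightarrow> complex \<Rightarrow> complex" where
  "ipd [] f = f"
| "ipd (v # vs) f = pd v (ipd vs f)"

definition smooth_on :: "complex set \<Rightarrow> (complex \<Rightarrow> complex) \<Rightarrow> bool" where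
  "smooth_on S f \<longleftrightarrow>
     (\<forall>vs. set vs \<subseteq> {1, \<i>} \<longrightarrow>
        continuous_on S (ipd vs f) \<and>
        (\<forall>v\<in>{1, \<i>}. \<forall>z\<in>S. (\<lambda>t::real. ipd vs f (z + of_real t * v)) differentiable (at 0)))"

text \<open>Delta = d^2/(dz d conj z) = (1/4)(d_xx + d_yy).\<close>
definition lap :: "(complex \<Rightarrow> complex) \<Rightarrow> complex \<Rightarrow> complex" where
  "lap f z = (pd 1 (pd 1 f) z + pd \<i> (pd \<i> f) z) / 4"

definition wgt :: "real \<Rightarrow> complex \<Rightarrow> real" where
  "wgt \<gamma> z = (1 - (cmod z)\<^sup>2) powr \<gamma>"

definition test_fun :: "(real \<Rightarrow> real) \<Rightarrow> bool" where
  "test_fun \<phi> \<longleftrightarrow> (\<forall>x. \<phi> (x + 2 * pi) = \<phi> x) \<and>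
     (\<forall>n x. (deriv ^^ n) \<phi> field_differentiable (at x))"

text \<open>Pairing of u_r with a test function, w.r.t. normalized arc length d theta / 2pi
  (so that the unit Dirac mass at 1 pairs to phi 0).\<close>
definition pair_r :: "(complex \<Rightarrow> complex) \<Rightarrow> real \<Rightarrow> (real \<Rightarrow> real) \<Rightarrow> complex" where
  "pair_r u r \<phi> = integral {0..2*pi} (\<lambda>\<theta>. u (complex_of_real r * cis \<theta>) * of_real (\<phi> \<theta>)) / of_real (2*pi)"

text \<open>u smooth in D, Delta (w_gamma^-1 Delta u) = 0 in D, u = delta_1 on T and
  d_n u = 0 on T, both in the distributional sense D'(T).\<close>
definition poisson_bvp :: "real \<Rightarrow> (complex \<Rightarrow> complex) \<Rightarrow> bool" where
  "poisson_bvp \<gamma> u \<longleftrightarrow>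
     smooth_on (ball 0 1) u \<and>
     (\<forall>z\<in>ball 0 1. lap (\<lambda>\<zeta>. lap u \<zeta> / of_real (wgt \<gamma> \<zeta>)) z = 0) \<and>
     (\<forall>\<phi>. test_fun \<phi> \<longrightarrow>
        ((\<lambda>r. pair_r u r \<phi>) \<longlongrightarrow> of_real (\<phi> 0)) (at_left 1) \<and>
        ((\<lambda>r. (pair_r u r \<phi> - of_real (\<phi> 0)) / of_real (1 - r)) \<longlongrightarrow> 0) (at_left 1))"

definition F2_formula :: "complex \<Rightarrow> complex" where
  "F2_formula z = of_real (
      1/2 * (1 - (cmod z)\<^sup>2)^4 / (cmod (1 - z))^2
    + 3/2 * (1 - (cmod z)\<^sup>2)^5 / (cmod (1 - z))^4
    - 3/2 * (1 - (cmod z)\<^sup>2)^4 / (cmod (1 - z))^4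
    + 3/2 * (1 - (cmod z)\<^sup>2)^6 / (cmod (1 - z))^6
    - 3/2 * (1 - (cmod z)\<^sup>2)^5 / (cmod (1 - z))^6
    + 1/2 * (1 - (cmod z)\<^sup>2)^7 / (cmod (1 - z))^8)"

end

theory Submission
  imports Defs "HOL-Complex_Analysis.Complex_Analysis"
begin

text \<open>
  Uniqueness: if \<open>u\<close> is a difference of two solutions, then \<open>lap u = (1 - |z|\<^sup>2)\<^sup>2 (a + cnj b)\<close> with
  \<open>a, b\<close> holomorphic. Integrating term by term, the n-th Fourier coefficient of \<open>u\<close> on the circle of
  radius \<open>r\<close> is \<open>r\<^sup>n (c + a\<^sub>n Q\<^sub>n(r\<^sup>2))\<close> with an explicit cubic \<open>Q\<^sub>n\<close> satisfying \<open>Q\<^sub>n'(1) > 0\<close>. Since it is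
  \<open>o(1 - r)\<close>, both \<open>c\<close> and \<open>a\<^sub>n\<close> vanish; negative modes are handled by conjugation.

  Existence: \<open>F\<^sub>2 = H + cnj H\<close>, where \<open>H\<close> is a cubic polynomial in \<open>cnj z\<close> with holomorphic coefficients
  and \<open>lap H = (1 - |z|\<^sup>2)\<^sup>2 (-6 z / (1 - z)\<^sup>5)\<close>. The circle means of \<open>F\<^sub>2\<close> equal 1, \<open>F\<^sub>2\<close> is symmetric under
  conjugation, and \<open>|F\<^sub>2| |1 - e\<^sup>i\<^sup>t|\<^sup>2\<close> is at most \<open>100 (1 - r\<^sup>2)\<^sup>2\<close> times the harmonic Poisson kernel; a
  second-order Taylor expansion of the test function then gives both boundary conditions.
\<close>

section \<open>Wirtinger derivatives on the unit disc\<close>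

text \<open>The kernel can be predicted from the mode formula. Demanding that
  \<open>r^n (c + d Q_n(r^2))\<close> have value 1 and derivative 0 at r = 1 forces n + 2 d Q_n'(1)
  = 0. Since Q_n'(1) is the Beta integral B(n+1, 3) = 2/((n+1)(n+2)(n+3)), this gives d =
  -n(n+1)(n+2)(n+3)/4, which is the n-th Taylor coefficient of -6 z/(1 - z)^5; the holomorphic part
  of H then has to supply c = 1 - d Q_n(1). The mode-by-mode computation settles uniqueness but not
  existence, because convergence in distributions has to be tested against every smooth function.
  Hence the pointwise estimate: the factor |1 - e^(it)|^2 tames the concentration of the kernel at 1
  and gains (1 - r^2)^2, one order more than the normal derivative requires. A test function minus
  its value at 0 vanishes only to first order at 0; the conjugation symmetry removes the linear
  term.\<close>

definition wirt :: "(complex \<Rightarrow> complex) \<Rightarrow> (complex \<Rightarrow> complex) \<Rightarrow> (complex \<Rightarrow> complex) \<Rightarrow> bool" where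
  "wirt f p q \<longleftrightarrow>
     (\<forall>z\<in>ball 0 1. (f has_derivative (\<lambda>v. p z * v + q z * cnj v)) (at z))"

text \<open>Line derivatives, as used in \<open>smooth_on\<close>, have no convenient calculus.
  Total derivatives in Wirtinger form obey the product and conjugation rules, and holomorphy is the
  case \<open>q = 0\<close>. The derivatives are existential witnesses, so values outside the disc
  do not interfere.\<close>

primrec Ck :: "nat \<Rightarrow> (complex \<Rightarrow> complex) \<Rightarrow> bool" where
  "Ck 0 f \<longleftrightarrow> continuous_on (ball 0 1) f"
| "Ck (Suc k) f \<longleftrightarrow> (\<exists>p q. wirt f p q \<and> Ck k p \<and> Ck k q)"

lemma has_derivative_cong_ball:
  assumes "(f has_derivative D) (at z)" "z \<in> ball 0 1" "\<And>w. w \<in> ball 0 1 \<Longrightarrow> f w = g w"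
  shows "(g has_derivative D) (at z)"
  using has_derivative_transform_within_open[OF assms(1) open_ball assms(2)] assms(3) by blast

lemma wirt_cong:
  assumes "wirt f p q" "\<And>z. z \<in> ball 0 1 \<Longrightarrow> f z = f' z"
    "\<And>z. z \<in> ball 0 1 \<Longrightarrow> p z = p' z" "\<And>z. z \<in> ball 0 1 \<Longrightarrow> q z = q' z"
  shows "wirt f' p' q'"
  unfolding wirt_def
proof
  fix z :: complex assume z: "z \<in> ball 0 1"
  have "(f has_derivative (\<lambda>v. p' z * v + q' z * cnj v)) (at z)"
    using assms(1) z by (simp add: wirt_def flip: assms(3,4)[OF z])
  then show "(f' has_derivative (\<lambda>v. p' z * v + q' z * cnj v)) (at z)"
    using has_derivative_cong_ball z assms(2) by blast
qed

lemma wirt_const: "wirt (\<lambda>z. c) (\<lambda>z. 0) (\<lambda>z. 0)"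
  by (simp add: wirt_def)

lemma wirt_add:
  assumes "wirt f p q" "wirt g p' q'"
  shows "wirt (\<lambda>z. f z + g z) (\<lambda>z. p z + p' z) (\<lambda>z. q z + q' z)"
  using assms unfolding wirt_def
  by (auto intro!: derivative_eq_intros simp: algebra_simps)

lemma wirt_mult:
  assumes "wirt f p q" "wirt g p' q'"
  shows "wirt (\<lambda>z. f z * g z) (\<lambda>z. p z * g z + f z * p' z) (\<lambda>z. q z * g z + f z * q' z)"
  using assms unfolding wirt_def
  by (auto intro!: derivative_eq_intros simp: algebra_simps)

lemma wirt_cmult:
  assumes "wirt f p q"
  shows "wirt (\<lambda>z. c * f z) (\<lambda>z. c * p z) (\<lambda>z. c * q z)"
  using wirt_mult[OF wirt_const[of c] assms] by simp

lemma wirt_cnj: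
  assumes "wirt f p q"
  shows "wirt (\<lambda>z. cnj (f z)) (\<lambda>z. cnj (q z)) (\<lambda>z. cnj (p z))"
  unfolding wirt_def
proof
  fix z :: complex assume "z \<in> ball 0 1"
  then have "(f has_derivative (\<lambda>v. p z * v + q z * cnj v)) (at z)"
    using assms by (auto simp: wirt_def)
  from bounded_linear.has_derivative[OF bounded_linear_cnj this]
  show "((\<lambda>z. cnj (f z)) has_derivative (\<lambda>v. cnj (q z) * v + cnj (p z) * cnj v)) (at z)"
    by (simp add: algebra_simps)
qed

lemma wirt_holomorphic:
  assumes "f holomorphic_on ball 0 1"
  shows "wirt f (deriv f) (\<lambda>z. 0)"
  unfolding wirt_def
proof
  fix z :: complex assume "z \<in> ball 0 1"
  then have "(f has_field_derivative deriv f z) (at z)"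
    using assms holomorphic_derivI open_ball by blast
  then show "(f has_derivative (\<lambda>v. deriv f z * v + 0 * cnj v)) (at z)"
    by (simp add: has_field_derivative_def)
qed

lemma holomorphic_if_wirt:
  assumes "wirt f p q" "\<And>z. z \<in> ball 0 1 \<Longrightarrow> q z = 0"
  shows "f holomorphic_on ball 0 1"
    "\<And>z. z \<in> ball 0 1 \<Longrightarrow> (f has_field_derivative p z) (at z)"
proof -
  show *: "(f has_field_derivative p z) (at z)" if "z \<in> ball 0 1" for z
    using assms that by (auto simp: wirt_def has_field_derivative_def)
  show "f holomorphic_on ball 0 1"
    using * by (meson holomorphic_on_open open_ball)
qed

lemma wirt_imp_continuous_on: "wirt f p q \<Longrightarrow> continuous_on (ball 0 1) f"
  by (auto simp: wirt_def continuous_on_eq_continuous_at intro: has_derivative_continuous)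

lemma Ck_imp_continuous_on: "Ck k f \<Longrightarrow> continuous_on (ball 0 1) f"
  by (cases k) (auto intro: wirt_imp_continuous_on)

lemma Ck_cong:
  assumes "Ck k f" "\<And>z. z \<in> ball 0 1 \<Longrightarrow> f z = g z"
  shows "Ck k g"
proof (cases k)
  case 0
  then show ?thesis using assms continuous_on_cong[of "ball 0 1" "ball 0 1" f g] by simp
next
  case (Suc n)
  then obtain p q where "wirt f p q" "Ck n p" "Ck n q" using assms by auto
  moreover from this(1) have "wirt g p q" by (rule wirt_cong) (use assms(2) in auto)
  ultimately show ?thesis using Suc by auto
qed

lemma Ck_SucD: "Ck (Suc k) f \<Longrightarrow> Ck k f"
proof (induction k arbitrary: f)
  case 0
  then show ?case using wirt_imp_continuous_on by auto
next
  case (Suc k)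
  then obtain p q where "wirt f p q" "Ck (Suc k) p" "Ck (Suc k) q"
    unfolding Ck.simps(2)[of "Suc k"] by blast
  with Suc.IH[of p] Suc.IH[of q] show ?case unfolding Ck.simps(2)[of k] by blast
qed

lemma Ck_const: "Ck k (\<lambda>z. c)"
  using wirt_const by (induction k arbitrary: c) auto

lemma Ck_add: "Ck k f \<Longrightarrow> Ck k g \<Longrightarrow> Ck k (\<lambda>z. f z + g z)"
proof (induction k arbitrary: f g)
  case 0
  then show ?case by (auto intro: continuous_on_add)
next
  case (Suc k)
  then obtain p q p' q' where w: "wirt f p q" "wirt g p' q'"
    and c: "Ck k p" "Ck k q" "Ck k p'" "Ck k q'" by auto
  show ?case using wirt_add[OF w] Suc.IH[OF c(1,3)] Suc.IH[OF c(2,4)] by auto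
qed

lemma Ck_mult: "Ck k f \<Longrightarrow> Ck k g \<Longrightarrow> Ck k (\<lambda>z. f z * g z)"
proof (induction k arbitrary: f g)
  case 0
  then show ?case by (auto intro: continuous_on_mult)
next
  case (Suc k)
  then obtain p q p' q' where w: "wirt f p q" "wirt g p' q'"
    and c: "Ck k p" "Ck k q" "Ck k p'" "Ck k q'" by auto
  have "Ck k f" "Ck k g" using Suc.prems Ck_SucD by blast+
  with c have "Ck k (\<lambda>z. p z * g z + f z * p' z)" "Ck k (\<lambda>z. q z * g z + f z * q' z)"
    by (auto intro!: Ck_add Suc.IH)
  with wirt_mult[OF w] show ?case by auto
qed

lemma Ck_diff: "Ck k f \<Longrightarrow> Ck k g \<Longrightarrow> Ck k (\<lambda>z. f z - g z)"
  using Ck_add[of k f "\<lambda>z. - 1 * g z"] Ck_mult[OF Ck_const, of k g "-1"] by simp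

lemma Ck_cnj: "Ck k f \<Longrightarrow> Ck k (\<lambda>z. cnj (f z))"
proof (induction k arbitrary: f)
  case 0
  then show ?case by (auto intro: continuous_on_cnj)
next
  case (Suc k)
  then obtain p q where w: "wirt f p q" and c: "Ck k p" "Ck k q" by auto
  show ?case using wirt_cnj[OF w] Suc.IH[OF c(1)] Suc.IH[OF c(2)] by auto
qed

lemma Ck_holomorphic: "f holomorphic_on ball 0 1 \<Longrightarrow> Ck k f"
proof (induction k arbitrary: f)
  case 0
  then show ?case by (simp add: holomorphic_on_imp_continuous_on)
next
  case (Suc k)
  have "deriv f holomorphic_on ball 0 1" using Suc.prems holomorphic_deriv by blast
  then have "Ck k (deriv f)" by (rule Suc.IH)
  then show ?case using wirt_holomorphic[OF Suc.prems] Ck_const[of k 0] by auto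
qed

section \<open>Comparison of \<open>Ck\<close> with the line derivatives of
  \<open>smooth_on\<close>\<close>

lemma pd_cong:
  assumes "z \<in> ball 0 1" "\<And>w. w \<in> ball 0 1 \<Longrightarrow> f w = g w"
  shows "pd v f z = pd v g z"
proof -
  have "((\<lambda>t::real. z + of_real t * v) \<longlongrightarrow> z) (nhds 0)"
    by (auto intro!: tendsto_eq_intros filterlim_ident)
  then have "\<forall>\<^sub>F t::real in nhds 0. z + of_real t * v \<in> ball 0 1"
    using assms(1) topological_tendstoD open_ball by blast
  then have "\<forall>\<^sub>F t::real in nhds 0. f (z + of_real t * v) = g (z + of_real t * v)"
    by eventually_elim (use assms(2) in auto)
  then show ?thesis
    unfolding pd_def by (intro vector_derivative_cong_eq) auto
qed

lemma wirt_imp_has_vector_derivative: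
  assumes "wirt f p q" "z \<in> ball 0 1"
  shows "((\<lambda>t::real. f (z + of_real t * v)) has_vector_derivative (p z * v + q z * cnj v)) (at 0)"
proof -
  have "(f has_derivative (\<lambda>v. p z * v + q z * cnj v)) (at (z + of_real 0 * v))"
    using assms by (auto simp: wirt_def)
  moreover have "((\<lambda>t::real. z + of_real t * v) has_derivative (\<lambda>t. of_real t * v)) (at 0)"
    by (auto intro!: derivative_eq_intros)
  ultimately have "(f \<circ> (\<lambda>t::real. z + of_real t * v) has_derivative
      (\<lambda>v. p z * v + q z * cnj v) \<circ> (\<lambda>t. of_real t * v)) (at 0)"
    by (intro diff_chain_at) auto
  then show ?thesis
    by (simp add: has_vector_derivative_def o_def scaleR_conv_of_real algebra_simps)
qed

lemma pd_wirt:
  assumes "wirt f p q" "z \<in> ball 0 1"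
  shows "pd v f z = p z * v + q z * cnj v"
  unfolding pd_def by (rule vector_derivative_at[OF wirt_imp_has_vector_derivative[OF assms]])

lemma Ck_pd:
  assumes "Ck (Suc k) f"
  shows "Ck k (pd v f)"
proof -
  obtain p q where pq: "wirt f p q" "Ck k p" "Ck k q" using assms by auto
  have "Ck k (\<lambda>z. p z * v + q z * cnj v)"
    by (intro Ck_add Ck_mult Ck_const pq)
  then show ?thesis by (rule Ck_cong) (simp add: pd_wirt[OF pq(1)])
qed

lemma Ck_ipd: "Ck (k + length vs) f \<Longrightarrow> Ck k (ipd vs f)"
proof (induction vs arbitrary: k)
  case (Cons v vs)
  then have "Ck (Suc k) (ipd vs f)" using Cons.IH[of "Suc k"] by (simp del: Ck.simps)
  then show ?case unfolding ipd.simps by (rule Ck_pd)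
qed simp

lemma smooth_on_if_Ck:
  assumes "\<And>k. Ck k f"
  shows "smooth_on (ball 0 1) f"
  unfolding smooth_on_def
proof (intro allI impI conjI ballI)
  fix vs :: "complex list"
  show "continuous_on (ball 0 1) (ipd vs f)"
    using Ck_ipd[of 0 vs f] assms by simp
  fix v z :: complex assume "z \<in> ball 0 1"
  moreover obtain p q where "wirt (ipd vs f) p q"
    using Ck_ipd[of 1 vs f] assms by auto
  ultimately show "(\<lambda>t::real. ipd vs f (z + of_real t * v)) differentiable at 0"
    using wirt_imp_has_vector_derivative differentiableI_vector by blast
qed

text \<open>Continuity of the derivative in direction \<open>\<i>\<close> merges the two line
  derivatives into a total one; its Wirtinger components are (f_x - i f_y)/2 and (f_x + i
  f_y)/2.\<close>

lemma wirt_if_continuous_partials: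
  assumes d1: "\<And>z. z \<in> ball 0 1 \<Longrightarrow> ((\<lambda>t::real. f (z + of_real t)) has_vector_derivative a z) (at 0)"
    and d2: "\<And>z. z \<in> ball 0 1 \<Longrightarrow> ((\<lambda>t::real. f (z + of_real t * \<i>)) has_vector_derivative b z) (at 0)"
    and cb: "continuous_on (ball 0 1) b"
  shows "wirt f (\<lambda>z. (a z - \<i> * b z) / 2) (\<lambda>z. (a z + \<i> * b z) / 2)"
  unfolding wirt_def
proof
  fix z :: complex assume z: "z \<in> ball 0 1"
  obtain e where e: "e > 0" "ball z e \<subseteq> ball 0 1"
    using z openE[OF open_ball] by blast
  define x y where "x = Re z" and "y = Im z"
  \<comment> \<open>Half-width \<open>e/2\<close> in both coordinates keeps the open rectangle
    inside the ball of radius \<open>e\<close>, because |w| is at most |Re w| + |Im w|.\<close>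
  define X where "X = {x - e/2<..<x + e/2}"
  define Y where "Y = {y - e/2<..<y + e/2}"
  have XY: "Complex s t \<in> ball 0 1" if "s \<in> X" "t \<in> Y" for s t
  proof -
    have "cmod (z - Complex s t) \<le> \<bar>x - s\<bar> + \<bar>y - t\<bar>"
      using cmod_le[of "z - Complex s t"] by (simp add: x_def y_def)
    also have "\<dots> < e" using that by (auto simp: X_def Y_def)
    finally show ?thesis using e by (auto simp: dist_norm subset_iff)
  qed
  define F where "F = (\<lambda>s t. f (Complex s t))"
  have dx: "((\<lambda>s. F s y) has_derivative (\<lambda>h. h *\<^sub>R a z)) (at x within X)"
  proof -
    have *: "((\<lambda>s. f (z + of_real (s - x))) has_vector_derivative a z) (at x)"
    proof -
      have "((\<lambda>t::real. f (z + of_real t)) \<circ> (\<lambda>s. s - x) has_vector_derivative 1 *\<^sub>R a z) (at x)"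
        using d1[OF z] by (intro vector_diff_chain_at) (auto intro!: derivative_eq_intros)
      then show ?thesis by (simp add: o_def)
    qed
    have "(\<lambda>s. f (z + of_real (s - x))) = (\<lambda>s. F s y)"
      by (auto simp: F_def x_def y_def complex_eq_iff intro!: arg_cong[of _ _ f])
    with * show ?thesis
      by (auto simp: has_vector_derivative_def intro: has_derivative_at_withinI)
  qed
  have dy: "((\<lambda>t. F s t) has_derivative blinfun_apply (blinfun_scaleR_left (b (Complex s t)))) (at t within Y)"
    if "s \<in> X" "t \<in> Y" for s t
  proof -
    have "((\<lambda>h::real. f (Complex s t + of_real h * \<i>)) \<circ> (\<lambda>r. r - t) has_vector_derivative
        1 *\<^sub>R b (Complex s t)) (at t)"
      using d2[OF XY[OF that]] by (intro vector_diff_chain_at) (auto intro!: derivative_eq_intros)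
    moreover have "(\<lambda>h::real. f (Complex s t + of_real h * \<i>)) \<circ> (\<lambda>r. r - t) = (\<lambda>t. F s t)"
      by (auto simp: F_def o_def complex_eq_iff intro!: arg_cong[of _ _ f])
    ultimately show ?thesis
      by (auto simp: has_vector_derivative_def intro: has_derivative_at_withinI)
  qed
  have xy: "x \<in> X" "y \<in> Y" using e by (auto simp: X_def Y_def)
  have "((\<lambda>(s, t). F s t) has_derivative
       (\<lambda>(h, k). h *\<^sub>R a z + blinfun_apply (blinfun_scaleR_left (b (Complex x y))) k)) (at (x, y) within X \<times> Y)"
  proof (rule has_derivative_partialsI[OF dx dy])
    have "continuous_on (X \<times> Y) (\<lambda>u. b (Complex (fst u) (snd u)))"
      using XY by (intro continuous_on_compose2[OF cb] continuous_intros) auto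
    then have "continuous_on (X \<times> Y) (\<lambda>(s, t). blinfun_scaleR_left (b (Complex s t)))"
      by (auto simp: split_beta intro!: continuous_intros)
    then show "continuous (at (x, y) within X \<times> Y) (\<lambda>(s, t). blinfun_scaleR_left (b (Complex s t)))"
      using xy by (simp add: continuous_on_eq_continuous_within)
  qed (use xy in \<open>auto simp: Y_def\<close>)
  moreover have "open (X \<times> Y)" by (auto simp: X_def Y_def intro!: open_Times)
  moreover have "Complex x y = z" by (simp add: x_def y_def)
  ultimately have D: "((\<lambda>u. F (fst u) (snd u)) has_derivative
       (\<lambda>u. fst u *\<^sub>R a z + snd u *\<^sub>R b z)) (at (Re z, Im z))"
    using xy at_within_open[of "(x, y)" "X \<times> Y"]
    by (simp add: split_beta' x_def[symmetric] y_def[symmetric])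
  have "((\<lambda>w. (Re w, Im w)) has_derivative (\<lambda>w. (Re w, Im w))) (at z)"
    by (auto intro!: derivative_eq_intros)
  from diff_chain_at[OF this D]
  have "(f has_derivative (\<lambda>w. Re w *\<^sub>R a z + Im w *\<^sub>R b z)) (at z)"
    by (simp add: o_def F_def)
  moreover have "(\<lambda>w. Re w *\<^sub>R a z + Im w *\<^sub>R b z) =
      (\<lambda>v. (a z - \<i> * b z) / 2 * v + (a z + \<i> * b z) / 2 * cnj v)"
    by (auto simp: complex_eq_iff field_simps)
  ultimately show "(f has_derivative (\<lambda>v. (a z - \<i> * b z) / 2 * v + (a z + \<i> * b z) / 2 * cnj v)) (at z)"
    by simp
qed

lemma ipd_append: "ipd (vs @ ws) f = ipd vs (ipd ws f)"
  by (induction vs) auto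

text \<open>Appending \<open>v\<close> on the right of a word of directions turns iterated
  derivatives of \<open>pd v f\<close> into iterated derivatives of \<open>f\<close>.\<close>

lemma smooth_on_pd:
  assumes "smooth_on S f" "v \<in> {1, \<i>}"
  shows "smooth_on S (pd v f)"
proof -
  have "ipd vs (pd v f) = ipd (vs @ [v]) f" for vs by (simp add: ipd_append)
  moreover have "set (vs @ [v]) \<subseteq> {1, \<i>}" if "set vs \<subseteq> {1, \<i>}" for vs
    using that assms by auto
  ultimately show ?thesis using assms(1) unfolding smooth_on_def by simp
qed

text \<open>Induction on \<open>k\<close>: the partial derivatives are again smooth, so the
  induction hypothesis applies to them and also supplies the continuity from which the total
  derivative of \<open>f\<close> is built.\<close>

lemma Ck_if_smooth_on: "smooth_on (ball 0 1) f \<Longrightarrow> Ck k f"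
proof (induction k arbitrary: f)
  case 0
  then have "continuous_on (ball 0 1) (ipd [] f)" unfolding smooth_on_def by (metis empty_set empty_subsetI)
  then show ?case by simp
next
  case (Suc k)
  have c: "Ck k (pd 1 f)" "Ck k (pd \<i> f)"
    using Suc smooth_on_pd by auto
  have "(\<lambda>t::real. ipd [] f (z + of_real t * v)) differentiable at 0" if "z \<in> ball 0 1" "v \<in> {1, \<i>}" for z v
    using Suc.prems that unfolding smooth_on_def by (metis empty_set empty_subsetI)
  then have d: "((\<lambda>t::real. f (z + of_real t * v)) has_vector_derivative pd v f z) (at 0)"
    if "z \<in> ball 0 1" "v \<in> {1, \<i>}" for z v
    using that by (simp add: pd_def vector_derivative_works)
  have "wirt f (\<lambda>z. (pd 1 f z - \<i> * pd \<i> f z) / 2) (\<lambda>z. (pd 1 f z + \<i> * pd \<i> f z) / 2)"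
    using d[of _ 1] d[of _ \<i>] Ck_imp_continuous_on[OF c(2)]
    by (intro wirt_if_continuous_partials) auto
  moreover have "Ck k (\<lambda>z. (pd 1 f z - \<i> * pd \<i> f z) * (1/2))" "Ck k (\<lambda>z. (pd 1 f z + \<i> * pd \<i> f z) * (1/2))"
    by (intro Ck_add Ck_diff Ck_mult Ck_const c)+
  ultimately show ?case by (auto simp: field_simps)
qed

section \<open>The Laplacian and harmonic functions\<close>

text \<open>The quotient is symmetric in \<open>v\<close> and \<open>w\<close>, so its limit,
  computed in both orders, will show that second derivatives commute. The proof is a mean value
  estimate in direction \<open>v\<close>, with the error controlled by differentiability of
  \<open>D x v\<close> at \<open>z\<close>.\<close>

lemma second_difference_tendsto:
  fixes f :: "'a::real_normed_vector \<Rightarrow> 'b::real_normed_vector"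
  assumes "open S" "z \<in> S"
    and D: "\<And>x. x \<in> S \<Longrightarrow> (f has_derivative D x) (at x)"
    and E: "((\<lambda>x. D x v) has_derivative E) (at z)"
  shows "((\<lambda>h::real. (f (z + h *\<^sub>R v + h *\<^sub>R w) - f (z + h *\<^sub>R v) - f (z + h *\<^sub>R w) + f z) /\<^sub>R h\<^sup>2)
           \<longlongrightarrow> E w) (at_right 0)"
proof (rule tendstoI)
  fix e :: real assume e: "e > 0"
  \<comment> \<open>Every \<open>t v + s w\<close> with \<open>t, s\<close> in [0, h] has norm at
    most \<open>h k\<close>. The choice \<open>e' = e/(4 k)\<close> makes the final error
    \<open>2 e' k = e/2\<close>.\<close>
  define k where "k = norm v + norm w + 1"
  have k: "k > 0" using norm_ge_zero[of v] norm_ge_zero[of w] unfolding k_def by linarith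
  define e' where "e' = e / (4 * k)"
  have e': "e' > 0" using e k by (simp add: e'_def)
  obtain d1 where d1: "d1 > 0"
    "\<And>x. norm (x - z) < d1 \<Longrightarrow> norm (D x v - D z v - E (x - z)) \<le> e' * norm (x - z)"
    using E e' unfolding has_derivative_at_alt by blast
  obtain d2 where d2: "d2 > 0" "ball z d2 \<subseteq> S"
    using assms(1,2) openE by blast
  have linE: "linear E" using E has_derivative_linear by blast
  define \<delta> where "\<delta> = min d1 d2 / k"
  have "\<delta> > 0" using d1 d2 k by (simp add: \<delta>_def)
  moreover have "dist ((f (z + h *\<^sub>R v + h *\<^sub>R w) - f (z + h *\<^sub>R v) - f (z + h *\<^sub>R w) + f z) /\<^sub>R h\<^sup>2) (E w) < e"
    if h: "0 < h" "h < \<delta>" for h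
  proof -
    \<comment> \<open>With the expected linear growth subtracted, the second difference is
      \<open>g h - g 0\<close> plus \<open>h\<^sup>2 E w\<close>, so it remains to show that
      \<open>g\<close> varies by o(h^2).\<close>
    define g where "g = (\<lambda>t. f (z + t *\<^sub>R v + h *\<^sub>R w) - f (z + t *\<^sub>R v) - t *\<^sub>R h *\<^sub>R E w)"
    have hk: "h * k < min d1 d2" using h k by (simp add: \<delta>_def pos_less_divide_eq)
    have near: "norm (t *\<^sub>R v + s *\<^sub>R w) \<le> h * k" if "t \<in> {0..h}" "s \<in> {0..h}" for t s
    proof -
      have "norm (t *\<^sub>R v + s *\<^sub>R w) \<le> \<bar>t\<bar> * norm v + \<bar>s\<bar> * norm w"
        by (metis norm_scaleR norm_triangle_ineq)
      also have "\<dots> \<le> h * norm v + h * norm w"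
        using that by (intro add_mono mult_right_mono) auto
      also have "\<dots> \<le> h * k" using h by (simp add: k_def algebra_simps)
      finally show ?thesis .
    qed
    have inS: "z + t *\<^sub>R v + s *\<^sub>R w \<in> S" if "t \<in> {0..h}" "s \<in> {0..h}" for t s
    proof -
      have "norm (t *\<^sub>R v + s *\<^sub>R w) < d2" using near[OF that] hk by linarith
      moreover have "dist z (z + t *\<^sub>R v + s *\<^sub>R w) = norm (t *\<^sub>R v + s *\<^sub>R w)"
        by (metis add.assoc add_diff_cancel_left' dist_commute dist_norm)
      ultimately show ?thesis using d2(2) by auto
    qed
    have line: "((\<lambda>t. f (z + t *\<^sub>R v + s *\<^sub>R w)) has_derivative (\<lambda>x. x *\<^sub>R D (z + t *\<^sub>R v + s *\<^sub>R w) v)) (at t)"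
      if "t \<in> {0..h}" "s \<in> {0..h}" for t s
    proof -
      have "((\<lambda>t. z + t *\<^sub>R v + s *\<^sub>R w) has_derivative (\<lambda>x. x *\<^sub>R v)) (at t)"
        by (auto intro!: derivative_eq_intros)
      from diff_chain_at[OF this D[OF inS[OF that]]]
      have "((\<lambda>t. f (z + t *\<^sub>R v + s *\<^sub>R w)) has_derivative (\<lambda>x. D (z + t *\<^sub>R v + s *\<^sub>R w) (x *\<^sub>R v))) (at t)"
        by (simp add: o_def)
      moreover have "linear (D (z + t *\<^sub>R v + s *\<^sub>R w))"
        using D[OF inS[OF that]] has_derivative_linear by blast
      ultimately show ?thesis by (simp add: linear_scale)
    qed
    define R where "R = (\<lambda>t. D (z + t *\<^sub>R v + h *\<^sub>R w) v - D (z + t *\<^sub>R v) v - h *\<^sub>R E w)"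
    have dg: "(g has_derivative (\<lambda>x. x *\<^sub>R R t)) (at t within {0..h})" if "t \<in> {0..h}" for t
    proof -
      have "(g has_derivative (\<lambda>x. x *\<^sub>R R t)) (at t)"
        unfolding g_def R_def
        using line[OF that, of h] line[OF that, of 0] h
        by (auto intro!: derivative_eq_intros simp: algebra_simps)
      then show ?thesis by (rule has_derivative_at_withinI)
    qed
    have R: "norm (R t) \<le> 2 * e' * (h * k)" if t: "t \<in> {0..h}" for t
    proof -
      \<comment> \<open>\<open>A\<close> and \<open>B\<close> are the first-order remainders of
        \<open>D x v\<close> about \<open>z\<close> at two points that differ by \<open>h w\<close>;
        the linear parts differ by exactly \<open>h E w\<close>.\<close>
      define A where "A = D (z + t *\<^sub>R v + h *\<^sub>R w) v - D z v - E (t *\<^sub>R v + h *\<^sub>R w)"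
      define B where "B = D (z + t *\<^sub>R v) v - D z v - E (t *\<^sub>R v)"
      have "R t = A - B"
        using linE by (simp add: R_def A_def B_def linear_add linear_scale)
      moreover have "norm A \<le> e' * (h * k)"
      proof -
        have n: "norm (t *\<^sub>R v + h *\<^sub>R w) \<le> h * k" using near[of t h] t h by auto
        have "norm A \<le> e' * norm (t *\<^sub>R v + h *\<^sub>R w)"
          using d1(2)[of "z + t *\<^sub>R v + h *\<^sub>R w"] n hk by (simp add: A_def add.assoc)
        also have "\<dots> \<le> e' * (h * k)" using n e' by simp
        finally show ?thesis .
      qed
      moreover have "norm B \<le> e' * (h * k)"
      proof -
        have n: "norm (t *\<^sub>R v) \<le> h * k" using near[of t 0] t h by auto
        have "norm B \<le> e' * norm (t *\<^sub>R v)"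
          using d1(2)[of "z + t *\<^sub>R v"] n hk unfolding B_def by (simp add: add.assoc)
        also have "\<dots> \<le> e' * (h * k)" using n e' by (intro mult_left_mono) auto
        finally show ?thesis .
      qed
      ultimately show ?thesis using norm_triangle_ineq4[of A B] by simp
    qed
    have on: "onorm (\<lambda>x. x *\<^sub>R R t) \<le> 2 * e' * (h * k)" if "t \<in> {0..h}" for t
      using R[OF that] by (intro onorm_le) (simp add: mult.commute mult_left_mono)
    have "norm (g h - g 0) \<le> 2 * e' * (h * k) * norm (h - 0)"
      by (rule differentiable_bound[OF _ dg on]) (use h in auto)
    then have b: "norm (g h - g 0) \<le> 2 * e' * k * h\<^sup>2"
      using h by (simp add: power2_eq_square mult_ac)
    have "f (z + h *\<^sub>R v + h *\<^sub>R w) - f (z + h *\<^sub>R v) - f (z + h *\<^sub>R w) + f z = (g h - g 0) + h\<^sup>2 *\<^sub>R E w"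
      by (simp add: g_def power2_eq_square)
    then have "(f (z + h *\<^sub>R v + h *\<^sub>R w) - f (z + h *\<^sub>R v) - f (z + h *\<^sub>R w) + f z) /\<^sub>R h\<^sup>2 - E w = (g h - g 0) /\<^sub>R h\<^sup>2"
      using h by (simp add: scaleR_add_right)
    then have "dist ((f (z + h *\<^sub>R v + h *\<^sub>R w) - f (z + h *\<^sub>R v) - f (z + h *\<^sub>R w) + f z) /\<^sub>R h\<^sup>2) (E w)
        = norm (g h - g 0) / h\<^sup>2"
      by (simp add: dist_norm divide_inverse mult.commute)
    also have "\<dots> \<le> 2 * e' * k" using b h by (simp add: divide_le_eq)
    also have "\<dots> < e" using e k by (simp add: e'_def)
    finally show ?thesis .
  qed
  ultimately show "\<forall>\<^sub>F h in at_right 0. dist ((f (z + h *\<^sub>R v + h *\<^sub>R w) - f (z + h *\<^sub>R v) - f (z + h *\<^sub>R w) + f z) /\<^sub>R h\<^sup>2) (E w) < e"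
    unfolding eventually_at_right_field by auto
qed

text \<open>Both mixed derivatives are limits of one second difference, with directions 1 and
  \<open>\<i>\<close> taken in either order.\<close>

lemma wirt_mixed_eq:
  assumes "wirt f p q" "wirt p p1 p2" "wirt q q1 q2" "z \<in> ball 0 1"
  shows "p2 z = q1 z"
proof -
  define D where "D = (\<lambda>x v. p x * v + q x * cnj v)"
  define E where "E = (\<lambda>v w. (p1 z * w + p2 z * cnj w) * v + (q1 z * w + q2 z * cnj w) * cnj v)"
  have D: "(f has_derivative D x) (at x)" if "x \<in> ball 0 1" for x
    using assms(1) that by (simp add: wirt_def D_def)
  have E: "((\<lambda>x. D x v) has_derivative E v) (at z)" for v
    using assms(2-4) unfolding wirt_def D_def E_def
    by (auto intro!: derivative_eq_intros)
  have "E 1 \<i> = E \<i> 1"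
  proof (rule tendsto_unique)
    show "((\<lambda>h::real. (f (z + h *\<^sub>R 1 + h *\<^sub>R \<i>) - f (z + h *\<^sub>R 1) - f (z + h *\<^sub>R \<i>) + f z) /\<^sub>R h\<^sup>2)
      \<longlongrightarrow> E 1 \<i>) (at_right 0)"
      by (rule second_difference_tendsto[OF open_ball assms(4) D E])
    have "((\<lambda>h::real. (f (z + h *\<^sub>R \<i> + h *\<^sub>R 1) - f (z + h *\<^sub>R \<i>) - f (z + h *\<^sub>R 1) + f z) /\<^sub>R h\<^sup>2)
      \<longlongrightarrow> E \<i> 1) (at_right 0)"
      by (rule second_difference_tendsto[OF open_ball assms(4) D E])
    then show "((\<lambda>h::real. (f (z + h *\<^sub>R 1 + h *\<^sub>R \<i>) - f (z + h *\<^sub>R 1) - f (z + h *\<^sub>R \<i>) + f z) /\<^sub>R h\<^sup>2)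
      \<longlongrightarrow> E \<i> 1) (at_right 0)"
      by (simp add: algebra_simps)
  qed simp
  then have "\<i> * (p1 z - p2 z + q1 z - q2 z) = \<i> * (p1 z + p2 z - q1 z - q2 z)"
    by (simp add: E_def algebra_simps)
  then have "p1 z - p2 z + q1 z - q2 z = p1 z + p2 z - q1 z - q2 z" by simp
  then have "2 * p2 z = 2 * q1 z" by (simp add: algebra_simps)
  then show ?thesis by simp
qed

text \<open>In d_xx + d_yy the terms \<open>p1\<close> and \<open>q2\<close> cancel and 2
  \<open>p2\<close> + 2 \<open>q1\<close> remains; equality of the mixed derivatives merges
  them.\<close>

lemma lap_wirt:
  assumes w: "wirt f p q" "wirt p p1 p2" "wirt q q1 q2" and z: "z \<in> ball 0 1"
  shows "lap f z = q1 z"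
proof -
  have 1: "wirt (\<lambda>x. p x + q x) (\<lambda>x. p1 x + q1 x) (\<lambda>x. p2 x + q2 x)"
    by (rule wirt_add[OF w(2,3)])
  have 2: "wirt (\<lambda>x. \<i> * p x + (- \<i>) * q x) (\<lambda>x. \<i> * p1 x + (- \<i>) * q1 x) (\<lambda>x. \<i> * p2 x + (- \<i>) * q2 x)"
    by (intro wirt_add wirt_cmult w)
  have "pd 1 (pd 1 f) z = pd 1 (\<lambda>x. p x + q x) z"
    by (rule pd_cong[OF z]) (simp add: pd_wirt[OF w(1)])
  also have "\<dots> = p1 z + q1 z + (p2 z + q2 z)"
    by (simp add: pd_wirt[OF 1 z])
  finally have a: "pd 1 (pd 1 f) z = p1 z + q1 z + (p2 z + q2 z)" .
  have "pd \<i> (pd \<i> f) z = pd \<i> (\<lambda>x. \<i> * p x + (- \<i>) * q x) z"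
    by (rule pd_cong[OF z]) (simp add: pd_wirt[OF w(1)])
  also have "\<dots> = - p1 z + q1 z + (p2 z - q2 z)"
    unfolding pd_wirt[OF 2 z] by (simp add: algebra_simps)
  finally show ?thesis
    using a wirt_mixed_eq[OF w z] by (simp add: lap_def)
qed

lemma Ck_2E:
  assumes "Ck 2 f"
  obtains p q p1 p2 q1 q2 where "wirt f p q" "wirt p p1 p2" "wirt q q1 q2"
  using assms by (auto simp: numeral_2_eq_2)

lemma lap_cong:
  assumes "z \<in> ball 0 1" "\<And>w. w \<in> ball 0 1 \<Longrightarrow> f w = g w"
  shows "lap f z = lap g z"
proof -
  have "pd v (pd v f) z = pd v (pd v g) z" for v
    by (rule pd_cong[OF assms(1)], rule pd_cong) (use assms(2) in auto)
  then show ?thesis by (simp add: lap_def)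
qed

lemma lap_add:
  assumes "Ck 2 f" "Ck 2 g" "z \<in> ball 0 1"
  shows "lap (\<lambda>x. f x + g x) z = lap f z + lap g z"
proof -
  obtain p q p1 p2 q1 q2 where f: "wirt f p q" "wirt p p1 p2" "wirt q q1 q2"
    using Ck_2E[OF assms(1)] .
  obtain p' q' p1' p2' q1' q2' where g: "wirt g p' q'" "wirt p' p1' p2'" "wirt q' q1' q2'"
    using Ck_2E[OF assms(2)] .
  show ?thesis
    using lap_wirt[OF wirt_add[OF f(1) g(1)] wirt_add[OF f(2) g(2)] wirt_add[OF f(3) g(3)]]
      lap_wirt[OF f] lap_wirt[OF g] assms(3) by simp
qed

lemma lap_cmult:
  assumes "Ck 2 f" "z \<in> ball 0 1"
  shows "lap (\<lambda>x. c * f x) z = c * lap f z"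
proof -
  obtain p q p1 p2 q1 q2 where f: "wirt f p q" "wirt p p1 p2" "wirt q q1 q2"
    using Ck_2E[OF assms(1)] .
  show ?thesis
    using lap_wirt[OF wirt_cmult[OF f(1)] wirt_cmult[OF f(2)] wirt_cmult[OF f(3)]]
      lap_wirt[OF f] assms(2) by simp
qed

lemma lap_diff:
  assumes "Ck 2 f" "Ck 2 g" "z \<in> ball 0 1"
  shows "lap (\<lambda>x. f x - g x) z = lap f z - lap g z"
proof -
  have "Ck 2 (\<lambda>x. (- 1) * g x)" by (intro Ck_mult Ck_const assms)
  then show ?thesis
    using lap_add[OF assms(1) _ assms(3), of "\<lambda>x. (- 1) * g x"] lap_cmult[OF assms(2,3), of "- 1"] by simp
qed

lemma lap_cnj:
  assumes "Ck 2 f" "z \<in> ball 0 1"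
  shows "lap (\<lambda>x. cnj (f x)) z = cnj (lap f z)"
proof -
  obtain p q p1 p2 q1 q2 where f: "wirt f p q" "wirt p p1 p2" "wirt q q1 q2"
    using Ck_2E[OF assms(1)] .
  show ?thesis
    using lap_wirt[OF wirt_cnj[OF f(1)] wirt_cnj[OF f(3)] wirt_cnj[OF f(2)] assms(2)]
      lap_wirt[OF f assms(2)] wirt_mixed_eq[OF f assms(2)] by simp
qed

lemma Ck_mult_cnj:
  assumes "f holomorphic_on ball 0 1" "g holomorphic_on ball 0 1"
  shows "Ck k (\<lambda>z. f z * cnj (g z))"
  using assms by (intro Ck_mult Ck_cnj Ck_holomorphic)

text \<open>d/dz acts on the holomorphic factor alone and d/dzbar on the antiholomorphic one. Every
  explicit Laplacian below is reduced to this product rule.\<close>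

lemma lap_mult_cnj:
  assumes f: "f holomorphic_on ball 0 1" and g: "g holomorphic_on ball 0 1" and z: "z \<in> ball 0 1"
  shows "lap (\<lambda>x. f x * cnj (g x)) z = deriv f z * cnj (deriv g z)"
proof -
  have f': "deriv f holomorphic_on ball 0 1" and g': "deriv g holomorphic_on ball 0 1"
    using f g holomorphic_deriv by blast+
  note wf = wirt_holomorphic[OF f] and wf' = wirt_holomorphic[OF f']
    and wg = wirt_cnj[OF wirt_holomorphic[OF g]] and wg' = wirt_cnj[OF wirt_holomorphic[OF g']]
  have "wirt (\<lambda>x. f x * cnj (g x)) (\<lambda>x. deriv f x * cnj (g x)) (\<lambda>x. f x * cnj (deriv g x))"
    using wirt_mult[OF wf wg] by simp
  from lap_wirt[OF this wirt_mult[OF wf' wg] wirt_mult[OF wf wg'] z] show ?thesis by simp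
qed

text \<open>A vanishing mixed derivative makes d/dz of \<open>u\<close> holomorphic. Subtracting a
  primitive of it leaves a function annihilated by d/dz, and the conjugate of such a function is
  holomorphic.\<close>

lemma harmonic_decomposition:
  assumes "Ck 2 u" and lap0: "\<And>z. z \<in> ball 0 1 \<Longrightarrow> lap u z = 0"
  obtains a b where "a holomorphic_on ball 0 1" "b holomorphic_on ball 0 1"
    "\<And>z. z \<in> ball 0 1 \<Longrightarrow> u z = a z + cnj (b z)"
proof -
  obtain p q p1 p2 q1 q2 where u: "wirt u p q" "wirt p p1 p2" "wirt q q1 q2"
    using Ck_2E[OF assms(1)] .
  have "p2 z = 0" if "z \<in> ball 0 1" for z
    using wirt_mixed_eq[OF u that] lap_wirt[OF u that] lap0[OF that] by simp
  then have "p holomorphic_on ball 0 1" by (rule holomorphic_if_wirt(1)[OF u(2)])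
  then obtain a where "\<And>z. z \<in> ball 0 1 \<Longrightarrow> (a has_field_derivative p z) (at z within ball 0 1)"
    using holomorphic_convex_primitive'[OF convex_ball open_ball] by blast
  then have a: "(a has_field_derivative p z) (at z)" if "z \<in> ball 0 1" for z
    using that by (metis at_within_open open_ball)
  then have wa: "wirt a p (\<lambda>z. 0)"
    by (simp add: wirt_def has_field_derivative_def)
  have "wirt (\<lambda>z. u z + (- 1) * a z) (\<lambda>z. p z + (- 1) * p z) (\<lambda>z. q z + (- 1) * 0)"
    by (intro wirt_add wirt_cmult u wa)
  from wirt_cnj[OF this]
  have "(\<lambda>z. cnj (u z + (- 1) * a z)) holomorphic_on ball 0 1"
    by (rule holomorphic_if_wirt(1)) simp
  moreover have "a holomorphic_on ball 0 1"
    using holomorphic_if_wirt(1)[OF wa] by simp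
  ultimately show thesis
    by (intro that[of a "\<lambda>z. cnj (u z + (- 1) * a z)"]) auto
qed

section \<open>Fourier modes on circles\<close>

definition mode :: "(complex \<Rightarrow> complex) \<Rightarrow> int \<Rightarrow> real \<Rightarrow> complex" where
  "mode u n r = integral {0..2*pi} (\<lambda>\<theta>. u (of_real r * cis \<theta>) * cis (- (of_int n * \<theta>))) / of_real (2*pi)"

definition coef :: "(complex \<Rightarrow> complex) \<Rightarrow> nat \<Rightarrow> complex" where
  "coef f n = (deriv ^^ n) f 0 / fact n"

lemma continuous_on_circle:
  assumes "continuous_on (ball 0 1) u" "0 < r" "r < 1"
  shows "continuous_on {0..2*pi} (\<lambda>\<theta>. u (of_real r * cis \<theta>))"
  by (rule continuous_on_compose2[OF assms(1)])
     (use assms in \<open>auto intro!: continuous_intros simp: norm_mult\<close>)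

lemma mode_integrable:
  assumes "continuous_on (ball 0 1) u" "0 < r" "r < 1"
  shows "(\<lambda>\<theta>. u (of_real r * cis \<theta>) * cis (- (of_int n * \<theta>))) integrable_on {0..2*pi}"
  by (intro integrable_continuous_interval continuous_intros continuous_on_circle assms)

lemma mode_cong:
  assumes "\<And>z. z \<in> ball 0 1 \<Longrightarrow> u z = v z" "0 < r" "r < 1"
  shows "mode u n r = mode v n r"
proof -
  have "u (of_real r * cis \<theta>) = v (of_real r * cis \<theta>)" for \<theta>
    using assms by (intro assms(1)) (simp add: norm_mult)
  then show ?thesis by (simp add: mode_def)
qed

lemma mode_add:
  assumes "continuous_on (ball 0 1) u" "continuous_on (ball 0 1) v" "0 < r" "r < 1"
  shows "mode (\<lambda>z. u z + v z) n r = mode u n r + mode v n r"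
  using integral_add[OF mode_integrable[OF assms(1,3,4), of n] mode_integrable[OF assms(2-4), of n]]
  by (simp add: mode_def algebra_simps add_divide_distrib)

lemma mode_cmult: "mode (\<lambda>z. c * u z) n r = c * mode u n r"
  by (simp add: mode_def mult.assoc)

lemma mode_cnj: "mode (\<lambda>z. cnj (u z)) n r = cnj (mode u (- n) r)"
  by (simp add: mode_def integral_cnj cis_cnj)

lemma mode_mult_power: "mode (\<lambda>z. z ^ k * u z) n r = of_real r ^ k * mode u (n - int k) r"
proof -
  have "(of_real r * cis \<theta>) ^ k * u (of_real r * cis \<theta>) * cis (- (of_int n * \<theta>))
      = of_real r ^ k * (u (of_real r * cis \<theta>) * cis (- (of_int (n - int k) * \<theta>)))" for \<theta>
    by (simp add: power_mult_distrib Complex.DeMoivre cis_mult algebra_simps)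
  then show ?thesis by (simp only: mode_def integral_mult_right) simp
qed

lemma mode_mult_cnj_power: "mode (\<lambda>z. cnj z ^ k * u z) n r = of_real r ^ k * mode u (n + int k) r"
  using mode_cnj[of "\<lambda>z. z ^ k * cnj (u z)" n r]
  by (simp add: mode_mult_power mode_cnj[of u] add.commute[of "int k"])

text \<open>Cauchy's formula for the n-th derivative on the circle of radius \<open>r\<close>,
  parametrized by the angle.\<close>

lemma mode_holomorphic_nonneg:
  assumes f: "f holomorphic_on ball 0 1" and r: "0 < r" "r < 1"
  shows "mode f (int n) r = of_real r ^ n * coef f n"
proof -
  have sub: "cball 0 r \<subseteq> ball (0::complex) 1" "ball 0 r \<subseteq> ball (0::complex) 1" using r by auto
  have "((\<lambda>u. f u / (u - 0) ^ Suc n) has_contour_integral (2 * pi * \<i>) / fact n * (deriv ^^ n) f 0) (circlepath 0 r)"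
    using sub r f
    by (intro Cauchy_has_contour_integral_higher_derivative_circlepath)
       (auto intro: holomorphic_on_imp_continuous_on holomorphic_on_subset)
  then have "((\<lambda>t. f (of_real r * cis t) / (of_real r * cis t) ^ Suc n * of_real r * \<i> * cis t) has_integral
      (2 * pi * \<i>) / fact n * (deriv ^^ n) f 0) {0..2*pi}"
    by (simp add: circlepath_def has_contour_integral_part_circlepath_iff)
  from has_integral_mult_right[OF this, of "of_real r ^ n / \<i>"]
  have "((\<lambda>t. f (of_real r * cis t) * cis (- (of_int (int n) * t))) has_integral
      of_real r ^ n / \<i> * ((2 * pi * \<i>) / fact n * (deriv ^^ n) f 0)) {0..2*pi}"
  proof (rule has_integral_eq[rotated])
    fix t
    have "cis (- (of_int (int n) * t)) = inverse (cis t ^ n)"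
      by (simp add: Complex.DeMoivre cis_inverse)
    then show "of_real r ^ n / \<i> * (f (of_real r * cis t) / (of_real r * cis t) ^ Suc n * of_real r * \<i> * cis t)
        = f (of_real r * cis t) * cis (- (of_int (int n) * t))"
      using r by (simp add: power_mult_distrib field_simps)
  qed
  moreover have "of_real r ^ n / \<i> * ((2 * pi * \<i>) / fact n * (deriv ^^ n) f 0) =
      of_real (2 * pi) * (of_real r ^ n * coef f n)"
    by (simp add: coef_def field_simps)
  ultimately have "integral {0..2*pi} (\<lambda>t. f (of_real r * cis t) * cis (- (of_int (int n) * t))) =
      of_real (2 * pi) * (of_real r ^ n * coef f n)"
    by (metis integral_unique)
  then show ?thesis by (simp add: mode_def)
qed

text \<open>Multiplication by \<open>z ^ n\<close> moves the index to 0, and the mean of a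
  holomorphic function that vanishes at 0 is 0.\<close>

lemma mode_holomorphic_neg:
  assumes f: "f holomorphic_on ball 0 1" and r: "0 < r" "r < 1" and n: "n > 0"
  shows "mode f (- int n) r = 0"
proof -
  have "of_real r ^ n * mode f (- int n) r = mode (\<lambda>z. z ^ n * f z) (int 0) r"
    by (simp add: mode_mult_power)
  also have "\<dots> = 0"
    using f r n by (subst mode_holomorphic_nonneg) (auto intro!: holomorphic_intros simp: coef_def)
  finally show ?thesis using r by simp
qed

lemma mode_cnj_holomorphic:
  assumes "f holomorphic_on ball 0 1" "0 < r" "r < 1"
  shows "mode (\<lambda>z. cnj (f z)) (int n) r = (if n = 0 then cnj (coef f 0) else 0)"
  using mode_holomorphic_neg[OF assms, of n] mode_holomorphic_nonneg[OF assms, of 0]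
  by (auto simp: mode_cnj)

text \<open>Instead of the Leibniz rule: coefficients are read off as modes on one circle, where a
  power of \<open>z\<close> only shifts the index. The radius 1/2 is an arbitrary choice and
  cancels.\<close>

lemma coef_mult_power:
  assumes f: "f holomorphic_on ball 0 1"
  shows "coef (\<lambda>z. z ^ k * f z) n = (if n < k then 0 else coef f (n - k))"
proof -
  have h: "(\<lambda>z. z ^ k * f z) holomorphic_on ball 0 1" using f by (intro holomorphic_intros)
  have r: "0 < (1/2::real)" "(1/2::real) < 1" by auto
  have "of_real (1/2) ^ n * coef (\<lambda>z. z ^ k * f z) n = of_real (1/2) ^ k * mode f (int n - int k) (1/2)"
    using mode_holomorphic_nonneg[OF h r, of n] mode_mult_power[of k f "int n" "1/2"] by simp
  also have "\<dots> = (if n < k then 0 else of_real (1/2) ^ n * coef f (n - k))"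
  proof (cases "n < k")
    case True
    then have "int n - int k = - int (k - n)" by simp
    then show ?thesis using True mode_holomorphic_neg[OF f r, of "k - n"] by simp
  next
    case False
    then have "int n - int k = int (n - k)" by simp
    then have "mode f (int n - int k) (1/2) = of_real (1/2) ^ (n - k) * coef f (n - k)"
      using mode_holomorphic_nonneg[OF f r, of "n - k"] by (simp only:)
    moreover have "of_real (1/2) ^ k * of_real (1/2) ^ (n - k) = (of_real (1/2) ^ n :: complex)"
      using False power_add[of "of_real (1/2) :: complex" k "n - k"] by simp
    ultimately show ?thesis using False by (simp only: if_False mult.assoc[symmetric])
  qed
  finally show ?thesis by (auto split: if_splits)
qed

lemma coef_deriv: "coef (deriv f) n = of_nat (Suc n) * coef f (Suc n)"
  by (simp add: coef_def funpow_swap1[of deriv] del: of_nat_Suc)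

lemma coef_cong:
  assumes "\<And>z. z \<in> ball 0 1 \<Longrightarrow> f z = g z"
  shows "coef f n = coef g n"
proof -
  have "eventually (\<lambda>z. f z = g z) (nhds 0)"
    using assms by (auto simp: eventually_nhds intro!: exI[of _ "ball 0 1"])
  then show ?thesis by (simp add: coef_def higher_deriv_cong_ev)
qed

lemma holomorphic_primitive_mult_power:
  assumes a: "a holomorphic_on ball 0 1"
  obtains A where "A holomorphic_on ball 0 1"
    "\<And>z. z \<in> ball 0 1 \<Longrightarrow> deriv A z = z ^ k * a z"
    "\<And>n. coef A n = (if n \<le> k then 0 else coef a (n - Suc k) / of_nat n)"
proof -
  have "(\<lambda>z. z ^ k * a z) holomorphic_on ball 0 1" using a by (intro holomorphic_intros)
  then obtain B where "\<And>z. z \<in> ball 0 1 \<Longrightarrow> (B has_field_derivative z ^ k * a z) (at z within ball 0 1)"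
    using holomorphic_convex_primitive'[OF convex_ball open_ball] by blast
  then have B: "(B has_field_derivative z ^ k * a z) (at z)" if "z \<in> ball 0 1" for z
    using that by (metis at_within_open open_ball)
  \<comment> \<open>Fixing the constant of integration makes the primitive vanish at 0 to order at
    least \<open>k + 1\<close>; this later removes the negative modes.\<close>
  define A where "A = (\<lambda>z. B z - B 0)"
  have A: "(A has_field_derivative z ^ k * a z) (at z)" if "z \<in> ball 0 1" for z
    unfolding A_def by (auto intro!: derivative_eq_intros B that)
  then have hol: "A holomorphic_on ball 0 1" by (meson holomorphic_on_open open_ball)
  have d: "deriv A z = z ^ k * a z" if "z \<in> ball 0 1" for z
    using A[OF that] DERIV_imp_deriv by blast
  have "coef A n = (if n \<le> k then 0 else coef a (n - Suc k) / of_nat n)" for n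
  proof (cases n)
    case 0
    then show ?thesis by (simp add: coef_def A_def)
  next
    case (Suc m)
    have "of_nat n * coef A n = coef (\<lambda>z. z ^ k * a z) m"
      using coef_deriv[of A m] coef_cong[of "deriv A" "\<lambda>z. z ^ k * a z" m] d Suc by simp
    also have "\<dots> = (if m < k then 0 else coef a (m - k))" by (rule coef_mult_power[OF a])
    finally show ?thesis using Suc by (auto simp: field_simps simp del: of_nat_Suc)
  qed
  with hol d show thesis by (rule that)
qed

text \<open>The radial factor of the n-th Fourier mode of a particular solution of
  \<open>lap u = wgt 2 * a\<close>; its derivative is \<open>s \<mapsto> \<integral>\<^sub>0\<^sup>1 t\<^sup>n (1 - s t)\<^sup>2 dt\<close>.\<close>

definition rad :: "nat \<Rightarrow> complex \<Rightarrow> complex" where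
  "rad n s = s / of_nat (n + 1) - s\<^sup>2 / of_nat (n + 2) + s ^ 3 / (3 * of_nat (n + 3))"

lemma wgt_2:
  assumes "z \<in> ball 0 1"
  shows "complex_of_real (wgt 2 z) = (1 - z * cnj z)\<^sup>2"
proof -
  have "cmod z ^ 2 < 1" using assms by (simp add: power_less_one_iff abs_square_less_1)
  then have "wgt 2 z = (1 - (cmod z)\<^sup>2)\<^sup>2" by (simp add: wgt_def powr_numeral)
  then show ?thesis by (simp add: complex_norm_square flip: complex_norm_square)
qed

text \<open>If A_k is a primitive of \<open>z ^ k * a z\<close>, then A_k times
  \<open>cnj z ^ Suc k\<close> has Laplacian \<open>of_nat (Suc k) * (z * cnj z) ^ k * a z\<close>.
  The combination with weights 1, -1, 1/3 for k = 0, 1, 2 therefore reproduces 1 - 2s + s^2 at s =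
  |z|^2, and the same weights give the three terms of \<open>rad\<close>.\<close>

lemma particular_solution:
  assumes a: "a holomorphic_on ball 0 1"
  obtains U where "\<And>k. Ck k U"
    "\<And>z. z \<in> ball 0 1 \<Longrightarrow> lap U z = of_real (wgt 2 z) * a z"
    "\<And>n r. 0 < r \<Longrightarrow> r < 1 \<Longrightarrow> mode U (int n) r = of_real r ^ n * (coef a n * rad n (of_real (r\<^sup>2)))"
    "\<And>n r. 0 < r \<Longrightarrow> r < 1 \<Longrightarrow> n > 0 \<Longrightarrow> mode U (- int n) r = 0"
proof -
  have "\<exists>A. A holomorphic_on ball 0 1 \<and> (\<forall>z\<in>ball 0 1. deriv A z = z ^ k * a z) \<and>
      (\<forall>n. coef A n = (if n \<le> k then 0 else coef a (n - Suc k) / of_nat n))" for k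
    using holomorphic_primitive_mult_power[OF a] by metis
  then obtain A where A: "\<And>k. A k holomorphic_on ball 0 1"
    "\<And>k z. z \<in> ball 0 1 \<Longrightarrow> deriv (A k) z = z ^ k * a z"
    "\<And>k n. coef (A k) n = (if n \<le> k then 0 else coef a (n - Suc k) / of_nat n)"
    by metis
  define T where "T = (\<lambda>k z. A k z * cnj (z ^ Suc k))"
  have CT: "Ck m (T k)" for m k
    unfolding T_def by (intro Ck_mult_cnj A holomorphic_intros)
  have lT: "lap (T k) z = of_nat (Suc k) * (z * cnj z) ^ k * a z" if z: "z \<in> ball 0 1" for k z
  proof -
    have "deriv (\<lambda>z::complex. z ^ Suc k) z = of_nat (Suc k) * z ^ k"
      by (rule DERIV_imp_deriv) (rule derivative_eq_intros refl | simp)+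
    moreover have "lap (T k) z = deriv (A k) z * cnj (deriv (\<lambda>z. z ^ Suc k) z)"
      unfolding T_def by (intro lap_mult_cnj A holomorphic_intros z)
    ultimately show ?thesis using A(2)[OF z] by (simp add: power_mult_distrib del: of_nat_Suc)
  qed
  have mT: "mode (T k) n r = of_real r ^ Suc k * mode (A k) (n + int (Suc k)) r" for k n r
    using mode_mult_cnj_power[of "Suc k" "A k" n r] by (simp add: T_def mult.commute)
  have mp: "mode (T k) (int n) r = of_real r ^ n * (coef a n * (of_real (r\<^sup>2) ^ Suc k / of_nat (n + Suc k)))"
    if "0 < r" "r < 1" for k n r
  proof -
    have "mode (A k) (int n + int (Suc k)) r = of_real r ^ (n + Suc k) * (coef a n / of_nat (n + Suc k))"
      using mode_holomorphic_nonneg[OF A(1) that, of k "n + Suc k"] A(3)[of k "n + Suc k"]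
      by (simp only: of_nat_add) simp
    then have "mode (T k) (int n) r = of_real r ^ Suc k * (of_real r ^ (n + Suc k) * (coef a n / of_nat (n + Suc k)))"
      by (simp only: mT)
    also have "\<dots> = of_real r ^ n * (coef a n * (of_real (r\<^sup>2) ^ Suc k / of_nat (n + Suc k)))"
      by (simp add: power_add power2_eq_square power_mult_distrib field_simps del: of_nat_Suc)
    finally show ?thesis .
  qed
  \<comment> \<open>Multiplication by \<open>cnj z ^ Suc k\<close> lowers indices by
    \<open>Suc k\<close>. Index -n of the product thus comes from index \<open>Suc k - n\<close> of
    \<open>A k\<close>, which is at most \<open>k\<close>, where \<open>A k\<close> has no
    coefficient.\<close>
  have mn: "mode (T k) (- int n) r = 0" if "0 < r" "r < 1" "n > 0" for k n r
  proof (cases "n \<le> Suc k")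
    case True
    then have "- int n + int (Suc k) = int (Suc k - n)" by simp
    moreover have "coef (A k) (Suc k - n) = 0" using that A(3) by simp
    ultimately show ?thesis
      using mode_holomorphic_nonneg[OF A(1) that(1,2), of k "Suc k - n"] by (simp only: mT mult_zero_right)
  next
    case False
    then have "- int n + int (Suc k) = - int (n - Suc k)" by simp
    moreover have "n - Suc k > 0" using False by simp
    ultimately show ?thesis
      using mode_holomorphic_neg[OF A(1) that(1,2), of "n - Suc k" k] by (simp only: mT mult_zero_right)
  qed
  define U where "U = (\<lambda>z. T 0 z + ((- 1) * T 1 z + (1/3) * T 2 z))"
  have C: "Ck m (\<lambda>z. (- 1) * T 1 z)" "Ck m (\<lambda>z. (1/3) * T 2 z)" "Ck m (\<lambda>z. (- 1) * T 1 z + (1/3) * T 2 z)" for m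
    by (intro Ck_add Ck_mult Ck_const CT)+
  have mU: "mode U n r = mode (T 0) n r + (- mode (T 1) n r + mode (T 2) n r / 3)" if "0 < r" "r < 1" for n r
    unfolding U_def using that
    by (simp only: mode_add[OF Ck_imp_continuous_on[OF CT] Ck_imp_continuous_on[OF C(3)]]
      mode_add[OF Ck_imp_continuous_on[OF C(1)] Ck_imp_continuous_on[OF C(2)]] mode_cmult) simp
  show thesis
  proof (rule that[of U])
    show "Ck k U" for k unfolding U_def by (intro Ck_add CT C)
    show "lap U z = of_real (wgt 2 z) * a z" if z: "z \<in> ball 0 1" for z
    proof -
      have "lap U z = lap (T 0) z + (- lap (T 1) z + lap (T 2) z / 3)"
        unfolding U_def using lap_add[OF CT C(3) z] lap_add[OF C(1) C(2) z]
          lap_cmult[OF CT z, of "- 1"] lap_cmult[OF CT z, of "1/3"] by simp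
      also have "\<dots> = (1 - z * cnj z)\<^sup>2 * a z"
        by (simp add: lT[OF z] power2_eq_square algebra_simps)
      finally show ?thesis by (simp add: wgt_2[OF z])
    qed
    show "mode U (int n) r = of_real r ^ n * (coef a n * rad n (of_real (r\<^sup>2)))" if r: "0 < r" "r < 1" for n r
      by (simp only: mU[OF r] mp[OF r] rad_def)
         (simp add: numeral_2_eq_2 numeral_3_eq_3 algebra_simps del: of_nat_Suc)
    show "mode U (- int n) r = 0" if "0 < r" "r < 1" "n > 0" for n r
      by (simp add: mU[OF that(1,2)] mn[OF that])
  qed
qed

section \<open>Uniqueness\<close>

lemma Ck_inverse:
  assumes "Ck k f" "\<And>z. z \<in> ball 0 1 \<Longrightarrow> f z \<noteq> 0"
  shows "Ck k (\<lambda>z. inverse (f z))"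
  using assms
proof (induction k arbitrary: f)
  case 0
  then show ?case by (auto intro!: continuous_on_inverse)
next
  case (Suc k)
  then obtain p q where w: "wirt f p q" and c: "Ck k p" "Ck k q" by auto
  have i: "Ck k (\<lambda>z. inverse (f z))" using Suc.IH Ck_SucD[OF Suc.prems(1)] Suc.prems(2) by blast
  define p' where "p' = (\<lambda>z. - 1 * (p z * (inverse (f z) * inverse (f z))))"
  define q' where "q' = (\<lambda>z. - 1 * (q z * (inverse (f z) * inverse (f z))))"
  have "Ck k p'" "Ck k q'" unfolding p'_def q'_def by (intro Ck_mult Ck_const c i)+
  moreover have "wirt (\<lambda>z. inverse (f z)) p' q'"
    unfolding wirt_def
  proof
    fix z :: complex assume z: "z \<in> ball 0 1"
    have "(f has_derivative (\<lambda>v. p z * v + q z * cnj v)) (at z)" using w z by (simp add: wirt_def)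
    from Deriv.has_derivative_inverse[OF Suc.prems(2)[OF z] this]
    show "((\<lambda>z. inverse (f z)) has_derivative (\<lambda>v. p' z * v + q' z * cnj v)) (at z)"
      by (simp add: p'_def q'_def algebra_simps)
  qed
  ultimately show ?case by auto
qed

lemma Ck_lap:
  assumes "Ck (Suc (Suc k)) u"
  shows "Ck k (lap u)"
proof -
  have "Ck k (\<lambda>z. (1/4) * (pd 1 (pd 1 u) z + pd \<i> (pd \<i> u) z))"
    using assms by (intro Ck_mult Ck_add Ck_const Ck_pd)
  then show ?thesis by (rule Ck_cong) (simp add: lap_def)
qed

lemma one_minus_norm_square_nonzero:
  assumes "z \<in> ball 0 1"
  shows "1 - z * cnj z \<noteq> 0"
proof -
  have "(cmod z)\<^sup>2 < 1" using assms by (simp add: abs_square_less_1)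
  then have "complex_of_real ((cmod z)\<^sup>2) \<noteq> 1" by (simp only: of_real_eq_1_iff)
  then show ?thesis by (simp flip: complex_norm_square)
qed

text \<open>Multiplying the hypothesis by 1 - r gives c + d Q_n(1) = 0 for Q_n =
  \<open>rad n\<close>. With this relation the quotient tends to -2 d Q_n'(1), and Q_n'(1) is not
  zero.\<close>

lemma radial_factor_zero:
  fixes c d :: complex
  assumes "((\<lambda>r. of_real r ^ n * (c + d * rad n (of_real (r\<^sup>2))) / of_real (1 - r)) \<longlongrightarrow> 0) (at_left (1::real))"
  shows "c = 0" "d = 0"
proof -
  define f :: "real \<Rightarrow> complex" where "f = (\<lambda>r. c + d * rad n (of_real (r\<^sup>2)))"
  have "((\<lambda>r. of_real r ^ n * f r / of_real (1 - r) / of_real r ^ n) \<longlongrightarrow> 0 / of_real 1 ^ n) (at_left (1::real))"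
    using assms unfolding f_def by (intro tendsto_intros) auto
  moreover have "\<forall>\<^sub>F r in at_left (1::real). of_real r ^ n * f r / of_real (1 - r) / of_real r ^ n = f r / of_real (1 - r)"
    using eventually_at_left_real[OF zero_less_one] by eventually_elim auto
  ultimately have "((\<lambda>r. f r / of_real (1 - r)) \<longlongrightarrow> 0 / of_real 1 ^ n) (at_left 1)"
    by (rule Lim_transform_eventually)
  then have 1: "((\<lambda>r. f r / of_real (1 - r)) \<longlongrightarrow> 0) (at_left 1)" by simp
  have "((\<lambda>r. f r / of_real (1 - r) * of_real (1 - r)) \<longlongrightarrow> 0 * of_real (1 - 1)) (at_left 1)"
    by (intro tendsto_intros 1)
  moreover have "\<forall>\<^sub>F r in at_left (1::real). f r / of_real (1 - r) * of_real (1 - r) = f r"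
    using eventually_at_left_real[OF zero_less_one] by eventually_elim (simp del: of_real_diff)
  ultimately have "(f \<longlongrightarrow> 0 * of_real (1 - 1)) (at_left 1)"
    by (rule Lim_transform_eventually)
  then have "(f \<longlongrightarrow> 0) (at_left 1)" by simp
  moreover have "(f \<longlongrightarrow> c + d * rad n (of_real (1\<^sup>2))) (at_left 1)"
    unfolding f_def rad_def by (intro tendsto_intros) (auto simp del: of_nat_add of_nat_Suc)
  ultimately have f1: "c + d * rad n 1 = 0"
    using tendsto_unique[of "at_left (1::real)"] by fastforce
  \<comment> \<open>The quotient of \<open>rad n s - rad n 1\<close> by \<open>s - 1\<close>, as a
    polynomial in \<open>s\<close>; hence \<open>k 1\<close> is the derivative of
    \<open>rad n\<close> at 1.\<close>
  define k :: "complex \<Rightarrow> complex" where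
    "k = (\<lambda>s. 1 / of_nat (n + 1) - (s + 1) / of_nat (n + 2) + (s\<^sup>2 + s + 1) / (3 * of_nat (n + 3)))"
  have fac: "rad n s - rad n 1 = (s - 1) * k s" for s
    unfolding rad_def k_def by (simp add: field_simps power2_eq_square power3_eq_cube del: of_nat_add of_nat_Suc)
  have "f r / of_real (1 - r) = - d * of_real (1 + r) * k (of_real (r\<^sup>2))" if "r < 1" for r
  proof -
    have "f r = d * (rad n (of_real (r\<^sup>2)) - rad n 1)" using f1 unfolding f_def
      by (metis add_diff_cancel_left add_eq_0_iff diff_0 diff_minus_eq_add mult_minus_right right_diff_distrib add.commute)
    also have "\<dots> = - d * of_real (1 + r) * k (of_real (r\<^sup>2)) * of_real (1 - r)"
      by (simp add: fac algebra_simps power2_eq_square)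
    finally show ?thesis using that by (simp del: of_real_diff)
  qed
  then have "\<forall>\<^sub>F r in at_left (1::real). f r / of_real (1 - r) = - d * of_real (1 + r) * k (of_real (r\<^sup>2))"
    using eventually_at_left_real[OF zero_less_one] by (auto elim: eventually_mono)
  with 1 have "((\<lambda>r. - d * of_real (1 + r) * k (of_real (r\<^sup>2))) \<longlongrightarrow> 0) (at_left (1::real))"
    by (rule Lim_transform_eventually)
  moreover have "((\<lambda>r. - d * of_real (1 + r) * k (of_real (r\<^sup>2))) \<longlongrightarrow> - d * of_real (1 + 1) * k (of_real (1\<^sup>2))) (at_left (1::real))"
    unfolding k_def by (intro tendsto_intros) (auto simp del: of_nat_add of_nat_Suc)
  ultimately have "d * k 1 = 0"
    using tendsto_unique[of "at_left (1::real)"] by fastforce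
  moreover have "k 1 = of_real (2 / (real (n + 1) * real (n + 2) * real (n + 3)))"
  proof -
    have "k 1 = of_real (1 / real (n + 1) - 2 / real (n + 2) + 1 / real (n + 3))"
      by (simp add: k_def del: of_nat_add of_nat_Suc)
    also have "1 / real (n + 1) - 2 / real (n + 2) + 1 / real (n + 3) = 2 / (real (n + 1) * real (n + 2) * real (n + 3))"
    proof -
      have nz: "real (n + 1) \<noteq> 0" "real (n + 2) \<noteq> 0" "real (n + 3) \<noteq> 0" by auto
      show ?thesis unfolding diff_frac_eq[OF nz(1,2)] add_frac_eq[OF no_zero_divisors[OF nz(1,2)] nz(3)]
        by (simp add: algebra_simps)
    qed
    finally show ?thesis .
  qed
  then have "k 1 \<noteq> 0" by (simp only: of_real_eq_0_iff) simp
  ultimately show "d = 0" by simp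
  then show "c = 0" using f1 by simp
qed

lemma mode_cnj_tendsto_0:
  assumes "\<And>n. ((\<lambda>r. mode u n r / of_real (1 - r)) \<longlongrightarrow> 0) (at_left 1)"
  shows "((\<lambda>r. mode (\<lambda>z. cnj (u z)) n r / of_real (1 - r)) \<longlongrightarrow> 0) (at_left 1)"
  using tendsto_cnj[OF assms[of "- n"]] by (simp add: mode_cnj)

text \<open>A constant can be moved between \<open>a\<close> and \<open>cnj b\<close>, so index 0
  carries one combined condition, while all higher coefficients of \<open>a\<close> and of
  \<open>b\<close> vanish separately.\<close>

lemma eq_minus_cnj_if_coef:
  assumes a: "a holomorphic_on ball 0 1" and b: "b holomorphic_on ball 0 1" and z: "z \<in> ball 0 1"
    and "\<And>n. coef a n + (if n = 0 then cnj (coef b 0) else 0) = 0"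
    and "\<And>n. coef b n + (if n = 0 then cnj (coef a 0) else 0) = 0"
  shows "a z + cnj (b z) = 0"
proof -
  have const: "f z = f 0" if f: "f holomorphic_on ball 0 1" "\<And>n. n > 0 \<Longrightarrow> coef f n = 0" for f
  proof (rule holomorphic_fun_eq_on_ball[OF f(1) _ z])
    show "(deriv ^^ n) f 0 = (deriv ^^ n) (\<lambda>_. f 0) 0" for n
      using f(2)[of n] by (cases "n = 0") (auto simp: coef_def)
  qed simp
  have "a z = a 0" "b z = b 0"
    using assms(4,5) const[OF a] const[OF b] by (metis add.right_neutral less_irrefl)+
  moreover have "a 0 + cnj (b 0) = 0" using assms(4)[of 0] by (simp add: coef_def)
  ultimately show ?thesis by simp
qed

text \<open>A particular solution for \<open>a\<close> and the conjugate of one for \<open>b\<close>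
  are subtracted from \<open>u\<close>. The remainder is harmonic; its modes have no radial factor
  besides \<open>r ^ n\<close> and supply \<open>c\<close>.\<close>

lemma mode_weighted:
  assumes u: "\<And>k. Ck k u" and a: "a holomorphic_on ball 0 1" and b: "b holomorphic_on ball 0 1"
    and lap_u: "\<And>z. z \<in> ball 0 1 \<Longrightarrow> lap u z = of_real (wgt 2 z) * (a z + cnj (b z))"
  obtains c where "\<And>r. 0 < r \<Longrightarrow> r < 1 \<Longrightarrow> mode u (int n) r = of_real r ^ n *
      (c + (coef a n + (if n = 0 then cnj (coef b 0) else 0)) * rad n (of_real (r\<^sup>2)))"
proof -
  obtain U where U: "\<And>k. Ck k U"
    "\<And>z. z \<in> ball 0 1 \<Longrightarrow> lap U z = of_real (wgt 2 z) * a z"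
    "\<And>n r. 0 < r \<Longrightarrow> r < 1 \<Longrightarrow> mode U (int n) r = of_real r ^ n * (coef a n * rad n (of_real (r\<^sup>2)))"
    using particular_solution[OF a] by metis
  obtain V where V: "\<And>k. Ck k V"
    "\<And>z. z \<in> ball 0 1 \<Longrightarrow> lap V z = of_real (wgt 2 z) * b z"
    "\<And>n r. 0 < r \<Longrightarrow> r < 1 \<Longrightarrow> mode V (int n) r = of_real r ^ n * (coef b n * rad n (of_real (r\<^sup>2)))"
    "\<And>n r. 0 < r \<Longrightarrow> r < 1 \<Longrightarrow> n > 0 \<Longrightarrow> mode V (- int n) r = 0"
    using particular_solution[OF b] by metis
  have C: "Ck k (\<lambda>z. U z + cnj (V z))" for k by (intro Ck_add Ck_cnj U V)
  have Cu: "Ck k (\<lambda>z. u z - (U z + cnj (V z)))" for k by (intro Ck_diff u C)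
  have "lap (\<lambda>z. u z - (U z + cnj (V z))) z = 0" if z: "z \<in> ball 0 1" for z
    using lap_diff[OF u C z] lap_add[OF U(1) Ck_cnj[OF V(1)] z] lap_cnj[OF V(1) z]
      U(2)[OF z] V(2)[OF z] lap_u[OF z] by (simp add: algebra_simps)
  then obtain h g where h: "h holomorphic_on ball 0 1" and g: "g holomorphic_on ball 0 1"
    and hg: "\<And>z. z \<in> ball 0 1 \<Longrightarrow> u z - (U z + cnj (V z)) = h z + cnj (g z)"
    using harmonic_decomposition[OF Cu] by blast
  have Ch: "Ck 0 (\<lambda>z. h z + cnj (g z))" by (intro Ck_add Ck_cnj Ck_holomorphic h g)
  show thesis
  proof (rule that[of "coef h n + (if n = 0 then cnj (coef g 0) else 0)"])
    fix r :: real assume r: "0 < r" "r < 1"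
    have "mode u (int n) r = mode (\<lambda>z. (h z + cnj (g z)) + (U z + cnj (V z))) (int n) r"
      using hg by (intro mode_cong r) (simp add: algebra_simps)
    also have "\<dots> = (mode h (int n) r + mode (\<lambda>z. cnj (g z)) (int n) r)
        + (mode U (int n) r + mode (\<lambda>z. cnj (V z)) (int n) r)"
      using mode_add[OF Ck_imp_continuous_on[OF Ch] Ck_imp_continuous_on[OF C] r]
        mode_add[OF Ck_imp_continuous_on[OF U(1)] Ck_imp_continuous_on[OF Ck_cnj[OF V(1)]] r]
        mode_add[OF Ck_imp_continuous_on[OF Ck_holomorphic[OF h]]
          Ck_imp_continuous_on[OF Ck_cnj[OF Ck_holomorphic[OF g]]] r] by simp
    \<comment> \<open>The conjugate of \<open>V\<close> has no modes of positive index, and its mean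
      has the real radial factor \<open>rad 0\<close>, the same as the mean of \<open>U\<close>, so
      the two contributions merge at \<open>n = 0\<close>.\<close>
    also have "mode (\<lambda>z. cnj (V z)) (int n) r = (if n = 0 then cnj (coef b 0) * rad 0 (of_real (r\<^sup>2)) else 0)"
      using V(3)[OF r, of 0] V(4)[OF r, of n] by (auto simp: mode_cnj rad_def)
    finally show "mode u (int n) r = of_real r ^ n *
       (coef h n + (if n = 0 then cnj (coef g 0) else 0)
        + (coef a n + (if n = 0 then cnj (coef b 0) else 0)) * rad n (of_real (r\<^sup>2)))"
      using mode_holomorphic_nonneg[OF h r, of n] mode_cnj_holomorphic[OF g r, of n] U(3)[OF r, of n]
      by (simp add: algebra_simps)
  qed
qed

text \<open>Indices \<open>n\<close> are nonnegative here; the coefficients of \<open>b\<close> are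
  obtained by applying the lemma to the conjugate of \<open>u\<close>, with \<open>a\<close> and
  \<open>b\<close> exchanged.\<close>

lemma coef_weighted_eq_0:
  assumes u: "\<And>k. Ck k u" and a: "a holomorphic_on ball 0 1" and b: "b holomorphic_on ball 0 1"
    and lap_u: "\<And>z. z \<in> ball 0 1 \<Longrightarrow> lap u z = of_real (wgt 2 z) * (a z + cnj (b z))"
    and lim: "\<And>n. ((\<lambda>r. mode u n r / of_real (1 - r)) \<longlongrightarrow> 0) (at_left 1)"
  shows "coef a n + (if n = 0 then cnj (coef b 0) else 0) = 0"
proof -
  define d where "d = coef a n + (if n = 0 then cnj (coef b 0) else 0)"
  obtain c where c: "\<And>r. 0 < r \<Longrightarrow> r < 1 \<Longrightarrow> mode u (int n) r = of_real r ^ n * (c + d * rad n (of_real (r\<^sup>2)))"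
    unfolding d_def using mode_weighted[OF u a b lap_u] by blast
  have "\<forall>\<^sub>F r in at_left (1::real). mode u (int n) r / of_real (1 - r) =
      of_real r ^ n * (c + d * rad n (of_real (r\<^sup>2))) / of_real (1 - r)"
    using eventually_at_left_real[OF zero_less_one] by (auto elim: eventually_mono simp: c)
  then have "((\<lambda>r. of_real r ^ n * (c + d * rad n (of_real (r\<^sup>2))) / of_real (1 - r)) \<longlongrightarrow> 0) (at_left (1::real))"
    by (rule Lim_transform_eventually[OF lim])
  then show ?thesis using radial_factor_zero(2) d_def by blast
qed

text \<open>The same radial argument with d = 0; this time the conclusion about the constant
  \<open>c\<close> is the one of interest.\<close>

lemma coef_harmonic_eq_0:
  assumes h: "h holomorphic_on ball 0 1" and g: "g holomorphic_on ball 0 1"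
    and u: "\<And>z. z \<in> ball 0 1 \<Longrightarrow> u z = h z + cnj (g z)"
    and lim: "\<And>n. ((\<lambda>r. mode u n r / of_real (1 - r)) \<longlongrightarrow> 0) (at_left 1)"
  shows "coef h n + (if n = 0 then cnj (coef g 0) else 0) = 0"
proof -
  define c where "c = coef h n + (if n = 0 then cnj (coef g 0) else 0)"
  have "mode u (int n) r = of_real r ^ n * (c + 0 * rad n (of_real (r\<^sup>2)))" if r: "0 < r" "r < 1" for r
  proof -
    have "mode u (int n) r = mode h (int n) r + mode (\<lambda>z. cnj (g z)) (int n) r"
      using mode_cong[OF u r] mode_add[OF Ck_imp_continuous_on[OF Ck_holomorphic[OF h]]
          Ck_imp_continuous_on[OF Ck_cnj[OF Ck_holomorphic[OF g]]] r] by simp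
    then show ?thesis
      using mode_holomorphic_nonneg[OF h r, of n] mode_cnj_holomorphic[OF g r, of n]
      by (simp add: c_def algebra_simps)
  qed
  then have "\<forall>\<^sub>F r in at_left (1::real). mode u (int n) r / of_real (1 - r) =
      of_real r ^ n * (c + 0 * rad n (of_real (r\<^sup>2))) / of_real (1 - r)"
    using eventually_at_left_real[OF zero_less_one] by (auto elim: eventually_mono)
  then have "((\<lambda>r. of_real r ^ n * (c + 0 * rad n (of_real (r\<^sup>2))) / of_real (1 - r)) \<longlongrightarrow> 0) (at_left (1::real))"
    by (rule Lim_transform_eventually[OF lim])
  then show ?thesis using radial_factor_zero(1) c_def by blast
qed

lemma Ck_lap_div_wgt:
  assumes u: "\<And>k. Ck k u"
  shows "Ck 2 (\<lambda>\<zeta>. lap u \<zeta> / of_real (wgt 2 \<zeta>))"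
proof -
  have id: "Ck 2 (\<lambda>z. z)" by (intro Ck_holomorphic holomorphic_intros)
  have "Ck 2 (\<lambda>z. (1 - z * cnj z)\<^sup>2)"
    unfolding power2_eq_square by (intro Ck_mult Ck_diff Ck_const Ck_cnj id)
  then have "Ck 2 (\<lambda>\<zeta>. lap u \<zeta> * inverse ((1 - \<zeta> * cnj \<zeta>)\<^sup>2))"
    using one_minus_norm_square_nonzero u by (intro Ck_mult Ck_lap Ck_inverse) auto
  then show ?thesis
    by (rule Ck_cong) (simp add: wgt_2 divide_inverse)
qed

text \<open>The modes are examined twice: first to annihilate \<open>a + cnj b\<close>, after which
  \<open>u\<close> is harmonic, and then to annihilate \<open>u\<close> itself. Each time both
  \<open>u\<close> and its conjugate are used, so that both holomorphic parts are reached.\<close>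

lemma weighted_biharmonic_eq_0:
  assumes u: "\<And>k. Ck k u"
    and eq: "\<And>z. z \<in> ball 0 1 \<Longrightarrow> lap (\<lambda>\<zeta>. lap u \<zeta> / of_real (wgt 2 \<zeta>)) z = 0"
    and lim: "\<And>n. ((\<lambda>r. mode u n r / of_real (1 - r)) \<longlongrightarrow> 0) (at_left 1)"
    and z: "z \<in> ball 0 1"
  shows "u z = 0"
proof -
  have nz: "(1 - z * cnj z)\<^sup>2 \<noteq> 0" if "z \<in> ball 0 1" for z
    using one_minus_norm_square_nonzero[OF that] by simp
  obtain a b where a: "a holomorphic_on ball 0 1" and b: "b holomorphic_on ball 0 1"
    and ab: "\<And>z. z \<in> ball 0 1 \<Longrightarrow> lap u z / of_real (wgt 2 z) = a z + cnj (b z)"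
    using harmonic_decomposition[OF Ck_lap_div_wgt[OF u] eq] by blast
  have lap_u: "lap u z = of_real (wgt 2 z) * (a z + cnj (b z))" if "z \<in> ball 0 1" for z
    using ab[OF that] nz[OF that] wgt_2[OF that] by (simp add: field_simps)
  have lap_cu: "lap (\<lambda>z. cnj (u z)) z = of_real (wgt 2 z) * (b z + cnj (a z))" if "z \<in> ball 0 1" for z
    using lap_cnj[OF u that] lap_u[OF that] by simp
  note lim' = mode_cnj_tendsto_0[OF lim]
  have "a z + cnj (b z) = 0" if "z \<in> ball 0 1" for z
    by (intro eq_minus_cnj_if_coef a b that coef_weighted_eq_0[OF u a b lap_u lim]
        coef_weighted_eq_0[OF Ck_cnj[OF u] b a lap_cu lim'])
  then have "lap u z = 0" if "z \<in> ball 0 1" for z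
    using lap_u that by simp
  then obtain h g where h: "h holomorphic_on ball 0 1" and g: "g holomorphic_on ball 0 1"
    and hg: "\<And>z. z \<in> ball 0 1 \<Longrightarrow> u z = h z + cnj (g z)"
    using harmonic_decomposition[OF u] by blast
  have hg': "cnj (u z) = g z + cnj (h z)" if "z \<in> ball 0 1" for z
    using hg[OF that] by simp
  have "h z + cnj (g z) = 0"
    by (intro eq_minus_cnj_if_coef h g z coef_harmonic_eq_0[OF h g hg lim]
        coef_harmonic_eq_0[OF g h hg' lim'])
  then show ?thesis using hg[OF z] by simp
qed

section \<open>The kernel solves the boundary value problem\<close>

text \<open>The coefficients of the powers of \<open>cnj z\<close> in H. With h = -6 z/(1 - z)^5,
  the functions \<open>G1\<close>, \<open>G2\<close>, \<open>G3\<close> are the primitives vanishing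
  at 0 of h, -z h and z^2 h/3, as in \<open>particular_solution\<close> for a = h. \<open>G0\<close>
  is the harmonic correction: its Taylor coefficients are 1/2 at index 0 and 1 - d Q_n(1) for n > 0,
  with d the n-th coefficient of h. The powers of \<open>z\<close> stand in front to display the
  order of vanishing.\<close>

definition G0 :: "complex \<Rightarrow> complex" where "G0 z = (1 + z * (1 - z) ^ 3) / (2 * (1 - z) ^ 4)"
definition G1 :: "complex \<Rightarrow> complex" where "G1 z = z ^ 2 * (- (6 - 4 * z + z ^ 2) / (2 * (1 - z) ^ 4))"
definition G2 :: "complex \<Rightarrow> complex" where "G2 z = z ^ 3 * ((4 - z) / (2 * (1 - z) ^ 4))"
definition G3 :: "complex \<Rightarrow> complex" where "G3 z = z ^ 4 * (- 1 / (2 * (1 - z) ^ 4))"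

definition F2_half :: "complex \<Rightarrow> complex" where
  "F2_half z = G0 z + (G1 z * cnj (z ^ 1) + (G2 z * cnj (z ^ 2) + G3 z * cnj (z ^ 3)))"

lemma one_minus_nonzero: "z \<in> ball 0 1 \<Longrightarrow> 1 - z \<noteq> (0::complex)"
  by auto

lemma holomorphic_G:
  shows "G0 holomorphic_on ball 0 1" "G1 holomorphic_on ball 0 1"
    "G2 holomorphic_on ball 0 1" "G3 holomorphic_on ball 0 1"
  unfolding G0_def G1_def G2_def G3_def
  using one_minus_nonzero by (auto intro!: holomorphic_intros)

lemma deriv_G:
  assumes "z \<in> ball 0 1"
  shows "deriv G1 z = - 6 * z / (1 - z) ^ 5"
    "deriv G2 z = 6 * z ^ 2 / (1 - z) ^ 5"
    "deriv G3 z = - 2 * z ^ 3 / (1 - z) ^ 5"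
proof -
  have nz: "1 - z \<noteq> 0" using one_minus_nonzero[OF assms] .
  show "deriv G1 z = - 6 * z / (1 - z) ^ 5"
    unfolding G1_def using nz
    by (intro DERIV_imp_deriv)
       (rule derivative_eq_intros refl | simp add: divide_simps | algebra)+
  show "deriv G2 z = 6 * z ^ 2 / (1 - z) ^ 5"
    unfolding G2_def using nz
    by (intro DERIV_imp_deriv)
       (rule derivative_eq_intros refl | simp add: divide_simps | algebra)+
  show "deriv G3 z = - 2 * z ^ 3 / (1 - z) ^ 5"
    unfolding G3_def using nz
    by (intro DERIV_imp_deriv)
       (rule derivative_eq_intros refl | simp add: divide_simps | algebra)+
qed

text \<open>The claimed decomposition after multiplication by \<open>2 (x y) ^ 4\<close>. Since
  \<open>w\<close> stands for \<open>cnj z\<close> but is an independent variable, conjugation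
  becomes the exchange of \<open>z\<close> and \<open>w\<close>, which swaps the two summands on the
  right.\<close>

lemma F2_polynomial_identity:
  fixes z w :: complex
  assumes "x = 1 - z" "y = 1 - w" "d = 1 - z * w"
  shows "d ^ 4 * (x * y) ^ 3 + 3 * (d ^ 5 - d ^ 4) * (x * y) ^ 2 + 3 * (d ^ 6 - d ^ 5) * (x * y) + d ^ 7
    = (1 + z * x ^ 3 - z ^ 2 * (6 - 4 * z + z ^ 2) * w + z ^ 3 * (4 - z) * w ^ 2 - z ^ 4 * w ^ 3) * y ^ 4
    + (1 + w * y ^ 3 - w ^ 2 * (6 - 4 * w + w ^ 2) * z + w ^ 3 * (4 - w) * z ^ 2 - w ^ 4 * z ^ 3) * x ^ 4"
  unfolding assms by algebra

lemma F2_formula_eq_F2_half: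
  assumes "z \<in> ball 0 1"
  shows "F2_formula z = F2_half z + cnj (F2_half z)"
proof -
  define x y d where "x = 1 - z" and "y = 1 - cnj z" and "d = 1 - z * cnj z"
  have nz: "x \<noteq> 0" "y \<noteq> 0"
    using one_minus_nonzero[OF assms] unfolding x_def y_def by (auto simp: complex_eq_iff)
  have m: "complex_of_real (cmod (1 - z)) ^ 2 = x * y"
    using complex_norm_square[of "1 - z"] by (simp add: x_def y_def)
  have "complex_of_real (cmod (1 - z)) ^ 4 = (x * y) ^ 2" "complex_of_real (cmod (1 - z)) ^ 6 = (x * y) ^ 3"
    "complex_of_real (cmod (1 - z)) ^ 8 = (x * y) ^ 4"
    by (simp_all flip: m power_mult)
  moreover have "1 - (complex_of_real (cmod z))\<^sup>2 = d"
    using complex_norm_square[of z] by (simp add: d_def)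
  ultimately have "F2_formula z = 1/2 * d ^ 4 / (x * y) + 3/2 * d ^ 5 / (x * y) ^ 2 - 3/2 * d ^ 4 / (x * y) ^ 2
    + 3/2 * d ^ 6 / (x * y) ^ 3 - 3/2 * d ^ 5 / (x * y) ^ 3 + 1/2 * d ^ 7 / (x * y) ^ 4"
    unfolding F2_formula_def by (simp add: m)
  also have "\<dots> = (d ^ 4 * (x * y) ^ 3 + 3 * (d ^ 5 - d ^ 4) * (x * y) ^ 2 + 3 * (d ^ 6 - d ^ 5) * (x * y) + d ^ 7)
    / (2 * (x * y) ^ 4)"
    using nz by (simp add: divide_simps) algebra
  also have "\<dots> = (1 + z * x ^ 3 - z ^ 2 * (6 - 4 * z + z ^ 2) * cnj z + z ^ 3 * (4 - z) * cnj z ^ 2 - z ^ 4 * cnj z ^ 3) / (2 * x ^ 4)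
    + (1 + cnj z * y ^ 3 - cnj z ^ 2 * (6 - 4 * cnj z + cnj z ^ 2) * z + cnj z ^ 3 * (4 - cnj z) * z ^ 2 - cnj z ^ 4 * z ^ 3) / (2 * y ^ 4)"
    unfolding F2_polynomial_identity[OF x_def y_def d_def] using nz
    by (simp add: add_divide_distrib power_mult_distrib)
  also have "(1 + z * x ^ 3 - z ^ 2 * (6 - 4 * z + z ^ 2) * cnj z + z ^ 3 * (4 - z) * cnj z ^ 2 - z ^ 4 * cnj z ^ 3) / (2 * x ^ 4) = F2_half z"
    unfolding F2_half_def G0_def G1_def G2_def G3_def x_def[symmetric]
    by (simp add: add_divide_distrib diff_divide_distrib ring_distribs mult_ac)
  also have "(1 + cnj z * y ^ 3 - cnj z ^ 2 * (6 - 4 * cnj z + cnj z ^ 2) * z + cnj z ^ 3 * (4 - cnj z) * z ^ 2 - cnj z ^ 4 * z ^ 3) / (2 * y ^ 4) = cnj (F2_half z)"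
    unfolding F2_half_def G0_def G1_def G2_def G3_def 
    by (simp add: y_def add_divide_distrib diff_divide_distrib ring_distribs mult_ac)
  finally show ?thesis .
qed

lemma Ck_F2_half_terms:
  shows "Ck k G0" "Ck k (\<lambda>z. G1 z * cnj (z ^ 1))" "Ck k (\<lambda>z. G2 z * cnj (z ^ 2))" "Ck k (\<lambda>z. G3 z * cnj (z ^ 3))"
  by (intro Ck_holomorphic Ck_mult_cnj holomorphic_G holomorphic_intros)+

lemma Ck_F2_half: "Ck k F2_half"
  unfolding F2_half_def by (intro Ck_add Ck_F2_half_terms)

lemma Ck_F2_formula: "Ck k F2_formula"
proof -
  have "Ck k (\<lambda>z. F2_half z + cnj (F2_half z))" by (intro Ck_add Ck_cnj Ck_F2_half)
  then show ?thesis by (rule Ck_cong) (simp add: F2_formula_eq_F2_half)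
qed

lemma lap_holomorphic:
  assumes "f holomorphic_on ball 0 1" "z \<in> ball 0 1"
  shows "lap f z = 0"
  using lap_mult_cnj[OF assms(1) holomorphic_on_const[of 1] assms(2)] by simp

lemma lap_F2_half:
  assumes z: "z \<in> ball 0 1"
  shows "lap F2_half z = of_real (wgt 2 z) * (- 6 * z / (1 - z) ^ 5)"
proof -
  have nz: "1 - z \<noteq> 0" using one_minus_nonzero[OF z] .
  have dp: "deriv (\<lambda>z::complex. z ^ Suc k) z = of_nat (Suc k) * z ^ k" for k
    by (rule DERIV_imp_deriv) (rule derivative_eq_intros refl | simp)+
  have "lap F2_half z = lap G0 z + (lap (\<lambda>z. G1 z * cnj (z ^ 1)) z
      + (lap (\<lambda>z. G2 z * cnj (z ^ 2)) z + lap (\<lambda>z. G3 z * cnj (z ^ 3)) z))"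
    unfolding F2_half_def
    by (simp only: lap_add[OF Ck_F2_half_terms(1) Ck_add[OF Ck_F2_half_terms(2) Ck_add[OF Ck_F2_half_terms(3,4)]] z]
      lap_add[OF Ck_F2_half_terms(2) Ck_add[OF Ck_F2_half_terms(3,4)] z] lap_add[OF Ck_F2_half_terms(3,4) z])
  also have "lap G0 z = 0" by (rule lap_holomorphic[OF holomorphic_G(1) z])
  also have "lap (\<lambda>z. G1 z * cnj (z ^ 1)) z = deriv G1 z * cnj (deriv (\<lambda>z. z ^ 1) z)"
    by (intro lap_mult_cnj holomorphic_G holomorphic_intros z)
  also have "lap (\<lambda>z. G2 z * cnj (z ^ 2)) z = deriv G2 z * cnj (deriv (\<lambda>z. z ^ 2) z)"
    by (intro lap_mult_cnj holomorphic_G holomorphic_intros z)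
  also have "lap (\<lambda>z. G3 z * cnj (z ^ 3)) z = deriv G3 z * cnj (deriv (\<lambda>z. z ^ 3) z)"
    by (intro lap_mult_cnj holomorphic_G holomorphic_intros z)
  also have "deriv (\<lambda>z::complex. z ^ 1) z = 1" using dp[of 0] by simp
  also have "deriv (\<lambda>z::complex. z ^ 2) z = 2 * z" using dp[of 1] by (simp add: numeral_2_eq_2)
  also have "deriv (\<lambda>z::complex. z ^ 3) z = 3 * z ^ 2" using dp[of 2] by (simp add: numeral_3_eq_3 numeral_2_eq_2)
  finally show ?thesis
    unfolding deriv_G[OF z] wgt_2[OF z] using nz by (simp add: field_simps) algebra
qed

text \<open>Dividing the Laplacian by the weight leaves \<open>h + cnj h\<close> with
  \<open>h\<close> holomorphic, which is harmonic.\<close>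

lemma F2_formula_weighted_biharmonic:
  assumes z: "z \<in> ball 0 1"
  shows "lap (\<lambda>\<zeta>. lap F2_formula \<zeta> / of_real (wgt 2 \<zeta>)) z = 0"
proof -
  define h :: "complex \<Rightarrow> complex" where "h = (\<lambda>z. - 6 * z / (1 - z) ^ 5)"
  have h: "h holomorphic_on ball 0 1"
    unfolding h_def using one_minus_nonzero by (auto intro!: holomorphic_intros)
  have "lap F2_formula \<zeta> / of_real (wgt 2 \<zeta>) = h \<zeta> + cnj (h \<zeta>)" if \<zeta>: "\<zeta> \<in> ball 0 1" for \<zeta>
  proof -
    have "lap F2_formula \<zeta> = lap (\<lambda>z. F2_half z + cnj (F2_half z)) \<zeta>"
      by (rule lap_cong[OF \<zeta> F2_formula_eq_F2_half])
    also have "\<dots> = of_real (wgt 2 \<zeta>) * (h \<zeta> + cnj (h \<zeta>))"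
      using lap_add[OF Ck_F2_half Ck_cnj[OF Ck_F2_half] \<zeta>] lap_cnj[OF Ck_F2_half \<zeta>] lap_F2_half[OF \<zeta>]
      by (simp add: h_def algebra_simps)
    finally show ?thesis
      using one_minus_norm_square_nonzero[OF \<zeta>] wgt_2[OF \<zeta>] by simp
  qed
  then have "lap (\<lambda>\<zeta>. lap F2_formula \<zeta> / of_real (wgt 2 \<zeta>)) z = lap (\<lambda>\<zeta>. h \<zeta> + cnj (h \<zeta>)) z"
    by (intro lap_cong z)
  also have "\<dots> = 0"
    using lap_add[OF Ck_holomorphic[OF h] Ck_cnj[OF Ck_holomorphic[OF h]] z]
      lap_cnj[OF Ck_holomorphic[OF h] z] lap_holomorphic[OF h z] by simp
  finally show ?thesis .
qed

text \<open>The holomorphic factor of \<open>cnj (z ^ j)\<close> vanishes at 0 to order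
  \<open>j + 1\<close>, too high to contribute to the mean; what remains is
  \<open>G0 0 = 1/2\<close>.\<close>

lemma mode_F2_half:
  assumes r: "0 < r" "r < 1"
  shows "mode F2_half 0 r = 1/2"
proof -
  have vanish: "mode (\<lambda>z. f z * cnj (z ^ j)) 0 r = 0"
    if f: "f = (\<lambda>z. z ^ Suc j * g z)" and g: "g holomorphic_on ball 0 1" for f g j
  proof -
    have hf: "f holomorphic_on ball 0 1" unfolding f using g by (intro holomorphic_intros)
    have "mode (\<lambda>z. f z * cnj (z ^ j)) 0 r = of_real r ^ j * mode f (int j) r"
      using mode_mult_cnj_power[of j f 0 r] by (simp add: mult.commute)
    also have "mode f (int j) r = 0"
      unfolding mode_holomorphic_nonneg[OF hf r] unfolding f coef_mult_power[OF g] by simp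
    finally show ?thesis by simp
  qed
  have "mode (\<lambda>z. G1 z * cnj (z ^ 1)) 0 r = 0"
    by (rule vanish[where g = "\<lambda>z. - (6 - 4 * z + z ^ 2) / (2 * (1 - z) ^ 4)"])
       (use one_minus_nonzero in \<open>auto simp: G1_def fun_eq_iff numeral_2_eq_2 intro!: holomorphic_intros\<close>)
  moreover have "mode (\<lambda>z. G2 z * cnj (z ^ 2)) 0 r = 0"
    by (rule vanish[where g = "\<lambda>z. (4 - z) / (2 * (1 - z) ^ 4)"])
       (use one_minus_nonzero in \<open>auto simp: G2_def fun_eq_iff numeral_3_eq_3 numeral_2_eq_2 intro!: holomorphic_intros\<close>)
  moreover have "mode (\<lambda>z. G3 z * cnj (z ^ 3)) 0 r = 0"
    by (rule vanish[where g = "\<lambda>z. - 1 / (2 * (1 - z) ^ 4)"])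
       (use one_minus_nonzero in \<open>auto simp: G3_def fun_eq_iff intro!: holomorphic_intros\<close>)
  moreover have "mode G0 0 r = 1/2"
    using mode_holomorphic_nonneg[OF holomorphic_G(1) r, of 0] by (simp add: coef_def G0_def)
  moreover note c = Ck_F2_half_terms[of 0, THEN Ck_imp_continuous_on]
  ultimately show ?thesis
    unfolding F2_half_def
    by (subst mode_add mode_add[OF c(2)] mode_add[OF c(3) c(4)], (intro c continuous_on_add r)+)+ simp
qed

lemma mode_F2_formula:
  assumes r: "0 < r" "r < 1"
  shows "mode F2_formula 0 r = 1"
proof -
  have "mode F2_formula 0 r = mode (\<lambda>z. F2_half z + cnj (F2_half z)) 0 r"
    by (rule mode_cong[OF F2_formula_eq_F2_half r])
  also have "\<dots> = mode F2_half 0 r + cnj (mode F2_half 0 r)"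
    using mode_add[OF Ck_imp_continuous_on[OF Ck_F2_half] Ck_imp_continuous_on[OF Ck_cnj[OF Ck_F2_half]] r, of 0]
    by (simp add: mode_cnj)
  finally show ?thesis by (simp add: mode_F2_half[OF r])
qed

section \<open>Harmonic Poisson kernel and comparison of |1 - e^(ix)| with |x|\<close>

lemma poisson_kernel_has_integral:
  assumes r: "0 < r" "r < 1"
  shows "((\<lambda>t. (1 - r\<^sup>2) / (cmod (1 - of_real r * cis t))\<^sup>2) has_integral 2 * pi) {0..2*pi}"
proof -
  \<comment> \<open>This is (1 + z)/(2 (1 - z)), half of the Herglotz kernel. Twice its real part is
    the Poisson kernel, and its mean is the value 1/2 at 0.\<close>
  define f :: "complex \<Rightarrow> complex" where "f = (\<lambda>z. 1 / (1 - z) - 1 / 2)"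
  have f: "f holomorphic_on ball 0 1"
    unfolding f_def using one_minus_nonzero by (auto intro!: holomorphic_intros)
  have eq: "complex_of_real ((1 - (cmod z)\<^sup>2) / (cmod (1 - z))\<^sup>2) = f z + cnj (f z)" if z: "z \<in> ball 0 1" for z
  proof -
    have "1 - z \<noteq> 0" "1 - cnj z \<noteq> 0" using one_minus_nonzero[OF z] by (auto simp: complex_eq_iff)
    then have "f z + cnj (f z) = (1 - z * cnj z) / ((1 - z) * (1 - cnj z))"
      by (simp add: f_def divide_simps) (simp add: algebra_simps)
    then show ?thesis using complex_norm_square[of z] complex_norm_square[of "1 - z"] by simp
  qed
  define P where "P = (\<lambda>t. (1 - r\<^sup>2) / (cmod (1 - of_real r * cis t))\<^sup>2)"
  have inb: "of_real r * cis t \<in> ball 0 1" for t using r by (simp add: norm_mult)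
  have "continuous_on {0..2*pi} P"
    unfolding P_def using one_minus_nonzero[OF inb] by (auto intro!: continuous_intros)
  then obtain I where I: "(P has_integral I) {0..2*pi}"
    using integrable_continuous_interval by blast
  have m0: "mode f 0 r = 1/2"
    using mode_holomorphic_nonneg[OF f r, of 0] by (simp add: coef_def f_def)
  have "mode (\<lambda>z. f z + cnj (f z)) 0 r = 1"
    using mode_add[OF Ck_imp_continuous_on[OF Ck_holomorphic[OF f]]
        Ck_imp_continuous_on[OF Ck_cnj[OF Ck_holomorphic[OF f]]] r, of 0] by (simp add: mode_cnj m0)
  moreover have "f (of_real r * cis t) + cnj (f (of_real r * cis t)) = of_real (P t)" for t
    using eq[OF inb[of t]] r by (simp add: P_def norm_mult)
  ultimately have "integral {0..2*pi} (\<lambda>t. complex_of_real (P t)) = of_real (2 * pi)"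
    by (simp add: mode_def)
  moreover have "((\<lambda>t. complex_of_real (P t)) has_integral of_real I) {0..2*pi}"
    using has_integral_linear[OF I bounded_linear_of_real] by (simp add: o_def)
  ultimately have "I = 2 * pi"
    using integral_unique of_real_eq_iff by metis
  then show ?thesis using I by (simp add: P_def)
qed

text \<open>The squared modulus is 2 (1 - cos x). For |x| up to 2 the quartic Taylor bound for cos
  gives at least 2 x^2/3. Beyond 2 the cosine is negative, so the squared modulus exceeds 2 while
  x^2 is at most 16; the constant 8 is 16/2.\<close>

lemma square_le_norm_one_minus_cis:
  assumes "\<bar>x\<bar> \<le> pi"
  shows "x\<^sup>2 \<le> 8 * (cmod (1 - cis x))\<^sup>2"
proof -
  have n: "(cmod (1 - cis x))\<^sup>2 = 2 * (1 - cos x)"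
    using sin_cos_squared_add[of x] unfolding cmod_power2 by (simp add: power2_eq_square algebra_simps)
  have x4: "x\<^sup>2 \<le> 16"
    using assms pi_less_4 power_mono[of "\<bar>x\<bar>" 4 2] by simp
  show ?thesis
  proof (cases "\<bar>x\<bar> \<le> 2")
    case True
    obtain t where "cos x = (\<Sum>m<4. cos_coeff m * x ^ m) + (cos (t + 1/2 * real 4 * pi) / fact 4) * x ^ 4"
      using Maclaurin_cos_expansion[of x 4] by blast
    also have "(\<Sum>m<4. cos_coeff m * x ^ m) = 1 - x\<^sup>2 / 2"
      by (simp add: cos_coeff_def lessThan_nat_numeral fact_numeral)
    also have "fact 4 = (24::real)" by (simp add: fact_numeral)
    finally have "cos x = 1 - x\<^sup>2 / 2 + cos (t + 1/2 * real 4 * pi) / 24 * x ^ 4" .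
    also have "cos (t + 1/2 * real 4 * pi) / 24 * x ^ 4 \<le> 1 / 24 * x ^ 4"
      by (intro mult_right_mono divide_right_mono) auto
    finally have "cos x \<le> 1 - x\<^sup>2 / 2 + 1 / 24 * x ^ 4" by simp
    moreover have "x ^ 4 \<le> 4 * x\<^sup>2"
    proof -
      have "x\<^sup>2 \<le> 4" using True power_mono[of "\<bar>x\<bar>" 2 2] by simp
      then have "x\<^sup>2 * x\<^sup>2 \<le> 4 * x\<^sup>2" by (intro mult_right_mono) auto
      then show ?thesis by (simp flip: power_add)
    qed
    ultimately show ?thesis unfolding n using zero_le_power2[of x] by argo
  next
    case False
    have "cos \<bar>x\<bar> \<le> cos 2" using False assms by (intro cos_monotone_0_pi_le) auto
    then have "cos x < 0" using cos_two_less_zero unfolding cos_abs_real by linarith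
    then show ?thesis unfolding n using x4 by argo
  qed
qed

section \<open>Test functions and the distributional boundary values of the kernel\<close>

lemma test_fun_DERIV:
  assumes "test_fun \<phi>"
  shows "DERIV ((deriv ^^ n) \<phi>) x :> (deriv ^^ Suc n) \<phi> x"
  using assms by (auto simp: test_fun_def DERIV_deriv_iff_field_differentiable)

lemma test_fun_continuous_on:
  assumes "test_fun \<phi>"
  shows "continuous_on S ((deriv ^^ n) \<phi>)"
  using test_fun_DERIV[OF assms] by (meson DERIV_isCont continuous_at_imp_continuous_on)

text \<open>Adding the values at \<open>t\<close> and \<open>- t\<close> cancels the linear Taylor
  term, leaving a second-order remainder. The expansion is made on [-pi, pi] and carried to
  [0, 2 pi] by periodicity.\<close>

lemma test_fun_second_difference_bound:
  assumes \<phi>: "test_fun \<phi>"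
  obtains M where "M \<ge> 0"
    "\<And>t. t \<in> {0..2*pi} \<Longrightarrow> \<bar>\<phi> t + \<phi> (- t) - 2 * \<phi> 0\<bar> \<le> M * (cmod (1 - cis t))\<^sup>2"
proof -
  have "compact ((deriv ^^ 2) \<phi> ` {-pi..pi})"
    by (intro compact_continuous_image test_fun_continuous_on \<phi>) auto
  then obtain B where B: "B > 0" "\<And>x. x \<in> {-pi..pi} \<Longrightarrow> \<bar>(deriv ^^ 2) \<phi> x\<bar> \<le> B"
    using compact_imp_bounded bounded_pos by (metis (no_types, lifting) imageI real_norm_def)
  have taylor: "\<bar>\<phi> x - \<phi> 0 - deriv \<phi> 0 * x\<bar> \<le> B / 2 * x\<^sup>2" if x: "\<bar>x\<bar> \<le> pi" for x
  proof -
    obtain t where t: "\<bar>t\<bar> \<le> \<bar>x\<bar>"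
      "\<phi> x = (\<Sum>m<2. ((deriv ^^ m) \<phi> 0 / fact m) * x ^ m) + ((deriv ^^ 2) \<phi> t / fact 2) * x ^ 2"
      using Maclaurin_all_le[of "\<lambda>m. (deriv ^^ m) \<phi>" \<phi> x 2] test_fun_DERIV[OF \<phi>] by auto
    have "\<phi> x - \<phi> 0 - deriv \<phi> 0 * x = ((deriv ^^ 2) \<phi> t / 2) * x\<^sup>2"
      unfolding t(2) by (simp add: numeral_2_eq_2)
    then have "\<bar>\<phi> x - \<phi> 0 - deriv \<phi> 0 * x\<bar> = \<bar>(deriv ^^ 2) \<phi> t\<bar> / 2 * x\<^sup>2"
      by (simp only: abs_mult abs_divide) simp
    also have "\<dots> \<le> B / 2 * x\<^sup>2"
    proof (intro mult_right_mono divide_right_mono)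
      have "t \<in> {-pi..pi}" using t(1) x by (simp only: atLeastAtMost_iff) linarith
      then show "\<bar>(deriv ^^ 2) \<phi> t\<bar> \<le> B" by (rule B(2))
    qed auto
    finally show ?thesis .
  qed
  have small: "\<bar>\<phi> x + \<phi> (- x) - 2 * \<phi> 0\<bar> \<le> 8 * B * (cmod (1 - cis x))\<^sup>2" if x: "\<bar>x\<bar> \<le> pi" for x
  proof -
    have "\<bar>\<phi> x + \<phi> (- x) - 2 * \<phi> 0\<bar> \<le> B * x\<^sup>2"
    proof -
      have "\<bar>\<phi> (- x) - \<phi> 0 + deriv \<phi> 0 * x\<bar> \<le> B / 2 * x\<^sup>2" using taylor[of "- x"] x by simp
      with taylor[OF x] show ?thesis unfolding abs_le_iff by argo
    qed
    also have "\<dots> \<le> B * (8 * (cmod (1 - cis x))\<^sup>2)"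
      using B(1) square_le_norm_one_minus_cis[OF x] by (intro mult_left_mono) auto
    finally show ?thesis by simp
  qed
  have per: "\<phi> (x + 2 * pi) = \<phi> x" for x using \<phi> by (simp add: test_fun_def)
  show thesis
  proof (rule that[of "8 * B"])
    fix t :: real assume t: "t \<in> {0..2*pi}"
    show "\<bar>\<phi> t + \<phi> (- t) - 2 * \<phi> 0\<bar> \<le> 8 * B * (cmod (1 - cis t))\<^sup>2"
    proof (cases "t \<le> pi")
      case True
      then show ?thesis using small[of t] t by simp
    next
      case False
      have "\<phi> t = \<phi> (t - 2 * pi)" using per[of "t - 2 * pi"] by simp
      moreover have "\<phi> (- (t - 2 * pi)) = \<phi> (- t)" using per[of "- t"] by (simp add: algebra_simps)
      moreover have "cis (t - 2 * pi) = cis t" by (simp add: complex_eq_iff cos_diff sin_diff)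
      moreover have "\<bar>t - 2 * pi\<bar> \<le> pi" using t False by auto
      ultimately show ?thesis using small[of "t - 2 * pi"] by simp
    qed
  qed (use B in simp)
qed

lemma F2_formula_bound:
  assumes r: "0 < r" "r < 1"
  shows "cmod (F2_formula (of_real r * cis t)) * (cmod (1 - cis t))\<^sup>2
    \<le> 100 * (1 - r\<^sup>2)\<^sup>2 * ((1 - r\<^sup>2) / (cmod (1 - of_real r * cis t))\<^sup>2)"
proof -
  define d where "d = cmod (1 - of_real r * cis t)"
  define e where "e = 1 - r\<^sup>2"
  have d1: "1 - r \<le> d"
    using norm_triangle_ineq2[of 1 "of_real r * cis t"] r by (simp add: d_def norm_mult)
  have d0: "d > 0" using d1 r by linarith
  have d2: "d \<le> 2"
    using norm_triangle_ineq4[of 1 "of_real r * cis t"] r by (simp add: d_def norm_mult)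
  have e0: "e > 0" "e \<le> 1" using r by (auto simp: e_def abs_square_less_1)
  have "e = (1 + r) * (1 - r)" by (simp add: e_def power2_eq_square algebra_simps)
  also have "\<dots> \<le> 2 * d" using d1 r by (intro mult_mono) auto
  finally have ed: "e \<le> 2 * d" .
  have "cmod (1 - cis t) \<le> cmod (1 - of_real r * cis t) + cmod (of_real r * cis t - cis t)"
    using norm_triangle_ineq[of "1 - of_real r * cis t" "of_real r * cis t - cis t"] by simp
  also have "of_real r * cis t - cis t = of_real (r - 1) * cis t" by (simp add: algebra_simps)
  also have "cmod \<dots> = 1 - r" using r by (simp add: norm_mult del: of_real_diff)
  finally have c: "cmod (1 - cis t) \<le> 2 * d" using d1 by (simp add: d_def)
  \<comment> \<open>\<open>T\<close> is \<open>e\<^sup>2\<close> times the harmonic Poisson kernel.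
    Factoring it out of \<open>d\<^sup>2 X\<close> leaves only \<open>e\<close>, \<open>d\<close>
    and \<open>q = e/d\<close>, which are bounded by 1, 2 and 2.\<close>
  define T where "T = e ^ 3 / d ^ 2"
  define q where "q = e / d"
  have q: "0 \<le> q" "q \<le> 2" using ed d0 e0 by (auto simp: q_def divide_simps)
  have q2: "q ^ 2 \<le> 4" "q ^ 4 \<le> 16" using power_mono[OF q(2,1), of 2] power_mono[OF q(2,1), of 4] by auto
  have T0: "T \<ge> 0" using e0 by (simp add: T_def)
  have dd: "d ^ 2 \<le> 4" using power_mono[OF d2, of 2] d0 by simp
  define X where "X = 1/2 * e ^ 4 / d ^ 2 + 3/2 * e ^ 5 / d ^ 4 - 3/2 * e ^ 4 / d ^ 4
    + 3/2 * e ^ 6 / d ^ 6 - 3/2 * e ^ 5 / d ^ 6 + 1/2 * e ^ 7 / d ^ 8"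
  have F: "F2_formula (of_real r * cis t) = of_real X"
    using r unfolding F2_formula_def X_def d_def e_def by (simp add: norm_mult)
  have "d ^ 2 * X = T * (1/2 * (e * d ^ 2) + 3/2 * e ^ 2 - 3/2 * e + 3/2 * (e * q ^ 2) - 3/2 * q ^ 2 + 1/2 * q ^ 4)"
    unfolding X_def T_def q_def using d0 by (simp add: field_simps) algebra
  then have "\<bar>d ^ 2 * X\<bar> = T * \<bar>1/2 * (e * d ^ 2) + 3/2 * e ^ 2 - 3/2 * e + 3/2 * (e * q ^ 2) - 3/2 * q ^ 2 + 1/2 * q ^ 4\<bar>"
    using T0 by (simp add: abs_mult)
  \<comment> \<open>The positive terms add up to at most 17.5 and the negative ones to at most 7.5;
    25 is the sum of both. The square of |1 - e^(it)| \<le> 2 d later contributes a factor 4, hence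
    100.\<close>
  also have "\<dots> \<le> T * 25"
  proof (rule mult_left_mono[OF _ T0])
    have "0 \<le> e * d ^ 2" "e * d ^ 2 \<le> 1 * 4" using e0 mult_mono[OF e0(2) dd] by auto
    moreover have "0 \<le> e * q ^ 2" "e * q ^ 2 \<le> 1 * 4" using e0 mult_mono[OF e0(2) q2(1)] by auto
    moreover have "0 \<le> e ^ 2" "e ^ 2 \<le> 1" using e0 by (auto simp: power_le_one)
    moreover have "0 \<le> q ^ 2" "0 \<le> q ^ 4" by auto
    ultimately show "\<bar>1/2 * (e * d ^ 2) + 3/2 * e ^ 2 - 3/2 * e + 3/2 * (e * q ^ 2) - 3/2 * q ^ 2 + 1/2 * q ^ 4\<bar> \<le> 25"
      using e0 q2 by linarith
  qed
  finally have b: "\<bar>d ^ 2 * X\<bar> \<le> T * 25" .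
  have "\<bar>X\<bar> * (cmod (1 - cis t))\<^sup>2 \<le> \<bar>X\<bar> * (2 * d)\<^sup>2"
    using c by (intro mult_left_mono power_mono) auto
  also have "\<dots> = 4 * \<bar>d ^ 2 * X\<bar>" by (simp add: abs_mult power_mult_distrib)
  also have "\<dots> \<le> 100 * T" using b by simp
  also have "\<dots> = 100 * e\<^sup>2 * (e / d\<^sup>2)" by (simp add: T_def power2_eq_square power3_eq_cube)
  finally show ?thesis by (simp add: F d_def e_def)
qed

text \<open>Symmetry in the real axis, written with \<open>2 * pi - t\<close> so that the interval
  of integration is mapped to itself.\<close>

lemma F2_formula_cis_reflect: "F2_formula (of_real r * cis (2 * pi - t)) = F2_formula (of_real r * cis t)"
proof -
  have "of_real r * cis (2 * pi - t) = cnj (of_real r * cis t)"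
    by (simp add: complex_eq_iff cos_diff sin_diff)
  moreover have "cmod (1 - cnj z) = cmod (1 - z)" for z
    by (metis complex_cnj_diff complex_cnj_one complex_mod_cnj)
  ultimately show ?thesis by (simp only: F2_formula_def complex_mod_cnj)
qed

lemma integral_reflect_2pi:
  fixes f :: "real \<Rightarrow> complex"
  assumes "f integrable_on {0..2*pi}"
  shows "integral {0..2*pi} (\<lambda>t. f (2 * pi - t)) = integral {0..2*pi} f"
proof -
  have "(f has_integral integral {0..2*pi} f) (cbox 0 (2*pi))"
    using assms by (simp add: integrable_integral)
  from has_integral_affinity[OF this, of "-1" "2*pi"]
  have "((\<lambda>t. f (2 * pi - t)) has_integral integral {0..2*pi} f) ((\<lambda>x. 2 * pi - x) ` {0..2*pi})"
    by (simp add: algebra_simps)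
  moreover have "(\<lambda>x. 2 * pi - x) ` {0..2*pi} = {0..2*pi::real}"
  proof (intro equalityI subsetI)
    fix x :: real assume "x \<in> {0..2*pi}"
    then show "x \<in> (\<lambda>x. 2 * pi - x) ` {0..2*pi}" by (intro image_eqI[of _ _ "2 * pi - x"]) auto
  qed auto
  ultimately show ?thesis by (simp add: integral_unique)
qed

lemma pair_r_integrable:
  assumes "continuous_on (ball 0 1) u" "continuous_on {0..2*pi} \<phi>" "0 < r" "r < 1"
  shows "(\<lambda>t. u (of_real r * cis t) * complex_of_real (\<phi> t)) integrable_on {0..2*pi}"
  using assms by (intro integrable_continuous_interval continuous_intros continuous_on_circle)

lemma pair_r_F2_formula_bound:
  assumes \<phi>: "test_fun \<phi>"
  obtains M where "\<And>r. 0 < r \<Longrightarrow> r < 1 \<Longrightarrow>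
    cmod (pair_r F2_formula r \<phi> - of_real (\<phi> 0)) \<le> M * (1 - r\<^sup>2)\<^sup>2"
proof -
  obtain M where M: "M \<ge> 0"
    "\<And>t. t \<in> {0..2*pi} \<Longrightarrow> \<bar>\<phi> t + \<phi> (- t) - 2 * \<phi> 0\<bar> \<le> M * (cmod (1 - cis t))\<^sup>2"
    using test_fun_second_difference_bound[OF \<phi>] by metis
  have c: "continuous_on S \<phi>" for S using test_fun_continuous_on[OF \<phi>, of S 0] by simp
  have c': "continuous_on S (\<lambda>t. \<phi> (- t))" for S
    by (rule continuous_on_compose2[OF c[of UNIV]]) (auto intro!: continuous_intros)
  have cF: "continuous_on (ball 0 1) F2_formula" by (rule Ck_imp_continuous_on[OF Ck_F2_formula])
  show thesis
  \<comment> \<open>The constant is \<open>100 M\<close> times the Poisson mass \<open>2 pi\<close>,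
    divided by the factor \<open>4 pi\<close> that relates \<open>J\<close> to the error.\<close>
  proof (rule that[of "50 * M"])
    fix r :: real assume r: "0 < r" "r < 1"
    define F where "F = (\<lambda>t. F2_formula (of_real r * cis t))"
    have i1: "(\<lambda>t. F t * of_real (\<phi> t)) integrable_on {0..2*pi}"
      unfolding F_def by (intro pair_r_integrable cF c r)
    have i2: "(\<lambda>t. F t * of_real (\<phi> (- t))) integrable_on {0..2*pi}"
      unfolding F_def by (intro pair_r_integrable[of _ "\<lambda>t. \<phi> (- t)"] cF c' r)
    have i3: "(\<lambda>t. F t * of_real (\<phi> 0)) integrable_on {0..2*pi}"
      unfolding F_def by (intro pair_r_integrable[of _ "\<lambda>t. \<phi> 0"] cF r) auto
    have "\<phi> (2 * pi - t) = \<phi> (- t)" for t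
      using \<phi> unfolding test_fun_def by (metis add.commute uminus_add_conv_diff)
    then have "integral {0..2*pi} (\<lambda>t. F t * of_real (\<phi> (- t))) = integral {0..2*pi} (\<lambda>t. F t * of_real (\<phi> t))"
      using integral_reflect_2pi[OF i1] by (simp add: F_def F2_formula_cis_reflect)
    moreover have "integral {0..2*pi} F = of_real (2 * pi)"
      using mode_F2_formula[OF r] by (simp add: mode_def F_def)
    then have "integral {0..2*pi} (\<lambda>t. F t * of_real (\<phi> 0)) = of_real (2 * pi) * of_real (\<phi> 0)"
      by simp
    \<comment> \<open>Averaging over the reflection replaces twice the pairing with
      \<open>\<phi>\<close> by a pairing with \<open>\<phi> t + \<phi> (- t)\<close>. As the kernel
      has mean 1, subtracting \<open>2 \<phi> 0\<close> subtracts the limit value, so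
      \<open>J\<close> is \<open>4 pi\<close> times the error.\<close>
    moreover define J where "J = integral {0..2*pi} (\<lambda>t. F t * of_real (\<phi> t + \<phi> (- t) - 2 * \<phi> 0))"
    have "J = integral {0..2*pi} (\<lambda>t. F t * of_real (\<phi> t)) + integral {0..2*pi} (\<lambda>t. F t * of_real (\<phi> (- t)))
        - 2 * integral {0..2*pi} (\<lambda>t. F t * of_real (\<phi> 0))"
    proof -
      have "J = integral {0..2*pi} (\<lambda>t. (F t * of_real (\<phi> t) + F t * of_real (\<phi> (- t))) - 2 * (F t * of_real (\<phi> 0)))"
        unfolding J_def by (simp add: algebra_simps)
      also have "\<dots> = integral {0..2*pi} (\<lambda>t. F t * of_real (\<phi> t) + F t * of_real (\<phi> (- t)))
          - integral {0..2*pi} (\<lambda>t. 2 * (F t * of_real (\<phi> 0)))"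
        by (intro integral_diff integrable_add i1 i2 integrable_on_mult_right i3)
      finally show ?thesis by (simp only: integral_add[OF i1 i2] integral_mult_right)
    qed
    moreover define I where "I = integral {0..2*pi} (\<lambda>t. F t * of_real (\<phi> t))"
    ultimately have "J = I + I - 2 * (of_real (2 * pi) * of_real (\<phi> 0))"
      by (simp only:)
    moreover have "pair_r F2_formula r \<phi> = I / of_real (2 * pi)"
      by (simp add: pair_r_def F_def I_def)
    ultimately have J: "J = of_real (4 * pi) * (pair_r F2_formula r \<phi> - of_real (\<phi> 0))"
      by (simp add: field_simps)
    define P where "P = (\<lambda>t. (1 - r\<^sup>2) / (cmod (1 - of_real r * cis t))\<^sup>2)"
    have P: "(P has_integral 2 * pi) {0..2*pi}"
      unfolding P_def by (rule poisson_kernel_has_integral[OF r])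
    have B: "((\<lambda>t. M * (100 * (1 - r\<^sup>2)\<^sup>2) * P t) has_integral M * (100 * (1 - r\<^sup>2)\<^sup>2) * (2 * pi)) {0..2*pi}"
      by (rule has_integral_mult_right[OF P])
    have iJ: "(\<lambda>t. F t * of_real (\<phi> t + \<phi> (- t) - 2 * \<phi> 0)) integrable_on {0..2*pi}"
      unfolding F_def by (intro pair_r_integrable[of _ "\<lambda>t. \<phi> t + \<phi> (- t) - 2 * \<phi> 0"] cF c c' r continuous_intros)
    have bd: "cmod (F t * of_real (\<phi> t + \<phi> (- t) - 2 * \<phi> 0)) \<le> M * (100 * (1 - r\<^sup>2)\<^sup>2) * P t"
      if t: "t \<in> {0..2*pi}" for t
    proof -
      have "cmod (F t * of_real (\<phi> t + \<phi> (- t) - 2 * \<phi> 0)) = cmod (F t) * \<bar>\<phi> t + \<phi> (- t) - 2 * \<phi> 0\<bar>"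
        by (simp only: norm_mult norm_of_real)
      also have "\<dots> \<le> cmod (F t) * (M * (cmod (1 - cis t))\<^sup>2)"
        using M(2)[OF t] by (intro mult_left_mono) auto
      also have "\<dots> = M * (cmod (F t) * (cmod (1 - cis t))\<^sup>2)" by simp
      also have "\<dots> \<le> M * (100 * (1 - r\<^sup>2)\<^sup>2 * P t)"
        unfolding F_def P_def using M(1) by (intro mult_left_mono F2_formula_bound r)
      finally show ?thesis by (simp add: mult.assoc)
    qed
    have "cmod J \<le> integral {0..2*pi} (\<lambda>t. M * (100 * (1 - r\<^sup>2)\<^sup>2) * P t)"
      unfolding J_def by (rule integral_norm_bound_integral[OF iJ has_integral_integrable[OF B] bd])
    then have "cmod J \<le> M * (100 * (1 - r\<^sup>2)\<^sup>2) * (2 * pi)"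
      by (simp only: integral_unique[OF B])
    moreover have "cmod J = 4 * pi * cmod (pair_r F2_formula r \<phi> - of_real (\<phi> 0))"
      unfolding J by (simp add: norm_mult)
    ultimately have "4 * pi * cmod (pair_r F2_formula r \<phi> - of_real (\<phi> 0)) \<le> 4 * pi * (50 * M * (1 - r\<^sup>2)\<^sup>2)"
      by (simp add: mult_ac)
    then show "cmod (pair_r F2_formula r \<phi> - of_real (\<phi> 0)) \<le> 50 * M * (1 - r\<^sup>2)\<^sup>2"
      by (simp only: mult_le_cancel_left_pos pi_gt_zero zero_less_mult_iff zero_less_numeral simp_thms)
  qed
qed

lemma poisson_bvp_F2_formula: "poisson_bvp 2 F2_formula"
  unfolding poisson_bvp_def
proof (intro conjI ballI allI impI)
  show "smooth_on (ball 0 1) F2_formula" by (rule smooth_on_if_Ck[OF Ck_F2_formula])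
  show "lap (\<lambda>\<zeta>. lap F2_formula \<zeta> / of_real (wgt 2 \<zeta>)) z = 0" if "z \<in> ball 0 1" for z
    by (rule F2_formula_weighted_biharmonic[OF that])
  fix \<phi> assume \<phi>: "test_fun \<phi>"
  obtain M where M: "\<And>r. 0 < r \<Longrightarrow> r < 1 \<Longrightarrow>
    cmod (pair_r F2_formula r \<phi> - of_real (\<phi> 0)) \<le> M * (1 - r\<^sup>2)\<^sup>2"
    using pair_r_F2_formula_bound[OF \<phi>] by metis
  have "\<forall>\<^sub>F r in at_left (1::real). cmod (pair_r F2_formula r \<phi> - of_real (\<phi> 0)) \<le> M * (1 - r\<^sup>2)\<^sup>2"
    using eventually_at_left_real[OF zero_less_one] by eventually_elim (use M in auto)
  moreover have "((\<lambda>r. M * (1 - r\<^sup>2)\<^sup>2) \<longlongrightarrow> 0) (at_left (1::real))"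
    by (rule tendsto_eq_intros refl | simp)+
  ultimately have "((\<lambda>r. pair_r F2_formula r \<phi> - of_real (\<phi> 0)) \<longlongrightarrow> 0) (at_left 1)"
    by (rule Lim_null_comparison)
  then show "((\<lambda>r. pair_r F2_formula r \<phi>) \<longlongrightarrow> of_real (\<phi> 0)) (at_left 1)"
    by (rule LIM_zero_cancel)
  have "\<forall>\<^sub>F r in at_left (1::real).
      cmod ((pair_r F2_formula r \<phi> - of_real (\<phi> 0)) / of_real (1 - r)) \<le> M * ((1 - r) * (1 + r)\<^sup>2)"
    using eventually_at_left_real[OF zero_less_one]
  proof eventually_elim
    case (elim r)
    then have r: "0 < r" "r < 1" by auto
    have "cmod ((pair_r F2_formula r \<phi> - of_real (\<phi> 0)) / of_real (1 - r))
        = cmod (pair_r F2_formula r \<phi> - of_real (\<phi> 0)) / (1 - r)"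
      using r by (simp add: norm_divide del: of_real_diff)
    also have "\<dots> \<le> M * (1 - r\<^sup>2)\<^sup>2 / (1 - r)"
      using M[OF r] r by (intro divide_right_mono) auto
    also have "(1 - r\<^sup>2)\<^sup>2 = (1 - r) * ((1 - r) * (1 + r)\<^sup>2)"
      by (simp add: power2_eq_square algebra_simps)
    finally show ?case using r by simp
  qed
  moreover have "((\<lambda>r. M * ((1 - r) * (1 + r)\<^sup>2)) \<longlongrightarrow> 0) (at_left (1::real))"
    by (rule tendsto_eq_intros refl | simp)+
  ultimately show "((\<lambda>r. (pair_r F2_formula r \<phi> - of_real (\<phi> 0)) / of_real (1 - r)) \<longlongrightarrow> 0) (at_left 1)"
    by (rule Lim_null_comparison)
qed

section \<open>From test functions to Fourier modes, and uniqueness\<close>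

lemma test_fun_cos_sin:
  "test_fun (\<lambda>x. a * cos (of_int n * x) + b * sin (of_int n * x))"
  unfolding test_fun_def
proof (intro conjI allI)
  fix x :: real
  have "of_int n * (x + 2 * pi) = of_int n * x + of_int n * (2 * pi)" by (simp add: algebra_simps)
  moreover have "sin (of_int n * (2 * pi)) = 0" "cos (of_int n * (2 * pi)) = 1"
    using sin_int_2pin[of n] cos_int_2pin[of n] by (simp_all add: mult.commute)
  ultimately show "a * cos (of_int n * (x + 2 * pi)) + b * sin (of_int n * (x + 2 * pi))
      = a * cos (of_int n * x) + b * sin (of_int n * x)"
    by (simp add: cos_add sin_add)
next
  fix k x
  have d: "((\<lambda>x. a * cos (of_int n * x) + b * sin (of_int n * x)) has_field_derivative
      (of_int n * b) * cos (of_int n * x) + (- of_int n * a) * sin (of_int n * x)) (at x)" for a b x :: real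
    by (auto intro!: derivative_eq_intros simp: algebra_simps)
  \<comment> \<open>The span of the two functions is closed under differentiation; leaving the
    amplitudes existential avoids tracking the sign pattern with period 4.\<close>
  have "\<exists>a' b'. (deriv ^^ k) (\<lambda>x. a * cos (of_int n * x) + b * sin (of_int n * x))
      = (\<lambda>x. a' * cos (of_int n * x) + b' * sin (of_int n * x))"
  proof (induction k)
    case (Suc k)
    then obtain a' b' where "(deriv ^^ k) (\<lambda>x. a * cos (of_int n * x) + b * sin (of_int n * x))
      = (\<lambda>x. a' * cos (of_int n * x) + b' * sin (of_int n * x))" by blast
    then have "(deriv ^^ Suc k) (\<lambda>x. a * cos (of_int n * x) + b * sin (of_int n * x))
      = (\<lambda>x. (of_int n * b') * cos (of_int n * x) + (- of_int n * a') * sin (of_int n * x))"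
      using DERIV_imp_deriv[OF d] by (simp only: funpow.simps o_apply) blast
    then show ?case by blast
  qed auto
  then show "(deriv ^^ k) (\<lambda>x. a * cos (of_int n * x) + b * sin (of_int n * x)) field_differentiable at x"
    using d unfolding field_differentiable_def by metis
qed

lemma pair_r_diff:
  assumes "continuous_on (ball 0 1) u" "continuous_on (ball 0 1) v" "continuous_on {0..2*pi} \<phi>" "0 < r" "r < 1"
  shows "pair_r (\<lambda>z. u z - v z) r \<phi> = pair_r u r \<phi> - pair_r v r \<phi>"
  using integral_diff[OF pair_r_integrable[OF assms(1,3-5)] pair_r_integrable[OF assms(2-5)]]
  by (simp add: pair_r_def left_diff_distrib diff_divide_distrib)

text \<open>Test functions are real valued, so the exponential is split into cosine and sine. The
  factors 1 and 0 are kept to match the shape of \<open>test_fun_cos_sin\<close>.\<close>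

lemma mode_eq_pair_r:
  assumes "continuous_on (ball 0 1) u" "0 < r" "r < 1"
  shows "mode u n r = pair_r u r (\<lambda>x. 1 * cos (of_int n * x) + 0 * sin (of_int n * x))
    - \<i> * pair_r u r (\<lambda>x. 0 * cos (of_int n * x) + 1 * sin (of_int n * x))"
proof -
  define p where "p = (\<lambda>t. u (of_real r * cis t) * complex_of_real (1 * cos (of_int n * t) + 0 * sin (of_int n * t)))"
  define q where "q = (\<lambda>t. u (of_real r * cis t) * complex_of_real (0 * cos (of_int n * t) + 1 * sin (of_int n * t)))"
  have p: "p integrable_on {0..2*pi}" and q: "q integrable_on {0..2*pi}"
    unfolding p_def q_def by (intro pair_r_integrable[OF assms(1) _ assms(2,3)] continuous_intros)+
  have "(\<lambda>t. u (of_real r * cis t) * cis (- (of_int n * t))) = (\<lambda>t. p t - \<i> * q t)"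
    by (simp add: fun_eq_iff p_def q_def complex_eq_iff algebra_simps)
  then have "integral {0..2*pi} (\<lambda>t. u (of_real r * cis t) * cis (- (of_int n * t)))
      = integral {0..2*pi} p - \<i> * integral {0..2*pi} q"
    using integral_diff[OF p integrable_on_mult_right[OF q, of \<i>]] by simp
  then show ?thesis by (simp add: mode_def pair_r_def p_def q_def diff_divide_distrib)
qed

text \<open>In the difference of the two normal-derivative quotients the terms
  \<open>\<phi> 0\<close> cancel. Every pairing of \<open>u\<close>, and hence every mode, is
  therefore o(1 - r).\<close>

lemma poisson_bvp_unique:
  assumes F: "poisson_bvp 2 F" and G: "poisson_bvp 2 G" and z: "z \<in> ball 0 1"
  shows "F z = G z"
proof -
  define u where "u = (\<lambda>z. F z - G z)"
  have CF: "Ck k F" and CG: "Ck k G" for k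
    using F G Ck_if_smooth_on unfolding poisson_bvp_def by blast+
  have Cu: "Ck k u" for k unfolding u_def by (intro Ck_diff CF CG)
  have cont: "continuous_on (ball 0 1) F" "continuous_on (ball 0 1) G" "continuous_on (ball 0 1) u"
    using CF CG Cu Ck_imp_continuous_on by blast+
  have pde: "lap (\<lambda>\<zeta>. lap u \<zeta> / of_real (wgt 2 \<zeta>)) z = 0" if z: "z \<in> ball 0 1" for z
  proof -
    have "lap (\<lambda>\<zeta>. lap u \<zeta> / of_real (wgt 2 \<zeta>)) z =
        lap (\<lambda>\<zeta>. lap F \<zeta> / of_real (wgt 2 \<zeta>) - lap G \<zeta> / of_real (wgt 2 \<zeta>)) z"
      unfolding u_def by (rule lap_cong[OF z]) (simp add: lap_diff[OF CF CG] diff_divide_distrib)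
    also have "\<dots> = 0"
      using lap_diff[OF Ck_lap_div_wgt[OF CF] Ck_lap_div_wgt[OF CG] z] F G z unfolding poisson_bvp_def by simp
    finally show ?thesis .
  qed
  have pair: "((\<lambda>r. pair_r u r \<phi> / of_real (1 - r)) \<longlongrightarrow> 0) (at_left 1)" if \<phi>: "test_fun \<phi>" for \<phi>
  proof -
    have "((\<lambda>r. (pair_r F r \<phi> - of_real (\<phi> 0)) / of_real (1 - r)
        - (pair_r G r \<phi> - of_real (\<phi> 0)) / of_real (1 - r)) \<longlongrightarrow> 0 - 0) (at_left 1)"
      using F G \<phi> unfolding poisson_bvp_def by (intro tendsto_diff) blast+
    then have lim: "((\<lambda>r. (pair_r F r \<phi> - of_real (\<phi> 0)) / of_real (1 - r)
        - (pair_r G r \<phi> - of_real (\<phi> 0)) / of_real (1 - r)) \<longlongrightarrow> 0) (at_left 1)" by simp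
    have c: "continuous_on {0..2*pi} \<phi>" using test_fun_continuous_on[OF \<phi>, of _ 0] by simp
    have "\<forall>\<^sub>F r in at_left (1::real). (pair_r F r \<phi> - of_real (\<phi> 0)) / of_real (1 - r)
        - (pair_r G r \<phi> - of_real (\<phi> 0)) / of_real (1 - r) = pair_r u r \<phi> / of_real (1 - r)"
      using eventually_at_left_real[OF zero_less_one]
      by eventually_elim (simp add: u_def pair_r_diff[OF cont(1,2) c] diff_divide_distrib)
    with lim show ?thesis by (rule Lim_transform_eventually)
  qed
  have "((\<lambda>r. mode u n r / of_real (1 - r)) \<longlongrightarrow> 0) (at_left 1)" for n
  proof -
    let ?p = "\<lambda>r. pair_r u r (\<lambda>x. 1 * cos (of_int n * x) + 0 * sin (of_int n * x)) / of_real (1 - r)"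
    let ?q = "\<lambda>r. pair_r u r (\<lambda>x. 0 * cos (of_int n * x) + 1 * sin (of_int n * x)) / of_real (1 - r)"
    have "((\<lambda>r. ?p r - \<i> * ?q r) \<longlongrightarrow> 0 - \<i> * 0) (at_left 1)"
      by (intro tendsto_diff tendsto_mult tendsto_const pair test_fun_cos_sin)
    moreover have "\<forall>\<^sub>F r in at_left (1::real). ?p r - \<i> * ?q r = mode u n r / of_real (1 - r)"
      using eventually_at_left_real[OF zero_less_one]
      by eventually_elim (simp only: mode_eq_pair_r[OF cont(3)] greaterThanLessThan_iff diff_divide_distrib times_divide_eq_right)
    ultimately have "((\<lambda>r. mode u n r / of_real (1 - r)) \<longlongrightarrow> 0 - \<i> * 0) (at_left 1)"
      by (rule Lim_transform_eventually)
    then show ?thesis by simp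
  qed
  from weighted_biharmonic_eq_0[OF Cu pde this z] show ?thesis by (simp add: u_def)
qed

theorem theorem3p2:
  shows "poisson_bvp 2 F2_formula \<and>
         (\<forall>F. poisson_bvp 2 F \<longrightarrow> (\<forall>z\<in>ball 0 1. F z = F2_formula z))"
  using poisson_bvp_F2_formula poisson_bvp_unique by blast

end
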